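(* Let $X$ be a Banach space, let $t_0<t_1$ be real numbers and let $\alpha>0$. Then $RL^{\alpha}([t_0,t_1];X)$ is continuously embedded in $C^{\alpha}([t_0,t_1];X)$. Moreover, if $\alpha\in\mathbb{N}$, then $RL^{\alpha}([t_0,t_1];X)=C^{\alpha}([t_0,t_1];X)$, whereas if $\alpha\notin\mathbb{N}$, then $RL^{\alpha}([t_0,t_1];X)\subsetneq C^{\alpha}([t_0,t_1];X)$.
   Context: $\mathbb{N}=\{0,1,2,\ldots\}$. $[\alpha]$ denotes the smallest integer greater than or equal to $\alpha$. For $\gamma>0$, $J_{t_0,t}^{\gamma}f(t)=\frac{1}{\Gamma(\gamma)}\int_{t_0}^{t}(t-s)^{\gamma-1}f(s)\,ds$ (Bochner integral), $J_{t_0,t}^0f=f$. The Riemann–Liouville derivative is $D_{t_0,t}^{\alpha}f(t)=\frac{d^{[\alpha]}}{dt^{[\alpha]}}\big[J_{t_0,t}^{[\alpha]-\alpha}f(t)\big]$ in the weak sense, and the Caputo derivative is $cD_{t_0,t}^{\alpha}f(t)=D_{t_0,t}^{\alpha}\Big[f(t)-\sum_{j=0}^{[\alpha]-1}\frac{f^{(j)}(t_0)}{j!}(t-t_0)^j\Big]$; for $\alpha\in\mathbb{N}$ both are understood as the $\alpha$-th weak derivative. For an integer $k\ge0$, the classical space of $k$-times continuously differentiable functions $C^k([t_0,t_1];X)$ has norm $\sum_{j=0}^k\sup_t\|f^{(j)}(t)\|_X$. $RL^{\alpha}([t_0,t_1];X)=\{f\in C^{[\alpha]-1}([t_0,t_1];X):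 D_{t_0,t}^{\alpha}f\in C^0([t_0,t_1];X)\}$ with norm $\|f\|_{C^{[\alpha]-1}}+\|D_{t_0,t}^{\alpha}f\|_{C^0}$, and $C^{\alpha}([t_0,t_1];X)=\{f\in C^{[\alpha]-1}([t_0,t_1];X): cD_{t_0,t}^{\alpha}f\in C^0([t_0,t_1];X)\}$ with norm $\|f\|_{C^{[\alpha]-1}}+\|cD_{t_0,t}^{\alpha}f\|_{C^0}$; membership in $C^0$ means the weak derivative exists and has a continuous representative on $[t_0,t_1]$.
   Formalization: The strict inclusion for α∉ℕ is stated only for a Banach space X ≠ {0}; for X = {0} both spaces equal {0} and strictness fails. The embedding and the equality for α∈ℕ are stated for every X. *)

theory Defs
  imports "HOL-Analysis.Analysis"
begin

text \<open>
  The library's Bochner integral is restricted to second-countable (i.e. separable) target spaces.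
  The following is its textbook definition for arbitrary Banach spaces: Borel measurability is
  replaced by strong measurability (pointwise limits of simple functions). The lemma
  \<open>has_bochner_int_iff_library\<close> below shows that nothing changes in the separable case.
\<close>

definition strongly_measurable :: "'b measure \<Rightarrow> ('b \<Rightarrow> 'a::real_normed_vector) \<Rightarrow> bool" where
  "strongly_measurable M f \<longleftrightarrow>
     (\<exists>s. (\<forall>i::nat. simple_function M (s i)) \<and> (\<forall>x\<in>space M. (\<lambda>i. s i x) \<longlonglongrightarrow> f x))"

definition has_bochner_int :: "'b measure \<Rightarrow> ('b \<Rightarrow> 'a::banach) \<Rightarrow> 'a \<Rightarrow> bool" where
  "has_bochner_int M f y \<longleftrightarrow> strongly_measurable M f \<and>
     (\<exists>s. (\<forall>i::nat. Bochner_Integration.simple_bochner_integrable M (s i)) \<and>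
          (\<lambda>i. \<integral>\<^sup>+x. norm (f x - s i x) \<partial>M) \<longlonglongrightarrow> 0 \<and>
          (\<lambda>i. Bochner_Integration.simple_bochner_integral M (s i)) \<longlonglongrightarrow> y)"

definition bochner_integrable :: "'b measure \<Rightarrow> ('b \<Rightarrow> 'a::banach) \<Rightarrow> bool" where
  "bochner_integrable M f \<longleftrightarrow> (\<exists>y. has_bochner_int M f y)"

definition bochner_int :: "'b measure \<Rightarrow> ('b \<Rightarrow> 'a::banach) \<Rightarrow> 'a" where
  "bochner_int M f = (if bochner_integrable M f then THE y. has_bochner_int M f y else 0)"

lemma strongly_measurable_norm_diff:
  assumes "strongly_measurable M f" "simple_function M s"
  shows "(\<lambda>x. norm (f x - s x)) \<in> borel_measurable M"
proof -
  obtain r where r: "\<And>i::nat. simple_function M (r i)"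
      "\<And>x. x \<in> space M \<Longrightarrow> (\<lambda>i. r i x) \<longlonglongrightarrow> f x"
    using assms(1) unfolding strongly_measurable_def by blast
  show ?thesis
  proof (rule borel_measurable_LIMSEQ_metric)
    show "(\<lambda>x. norm (r i x - s x)) \<in> borel_measurable M" for i
      by (rule borel_measurable_simple_function)
         (rule simple_function_compose2[OF r(1) assms(2), of "\<lambda>u v. norm (u - v)"])
    show "(\<lambda>i. norm (r i x - s x)) \<longlonglongrightarrow> norm (f x - s x)" if "x \<in> space M" for x
      using r(2)[OF that] by (intro tendsto_intros)
  qed
qed

lemma has_bochner_int_unique:
  assumes "has_bochner_int M f y" "has_bochner_int M f z"
  shows "y = z"
proof -
  have sm: "strongly_measurable M f"
    using assms(1) by (simp add: has_bochner_int_def)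
  obtain s where s: "\<And>i::nat. Bochner_Integration.simple_bochner_integrable M (s i)"
      "(\<lambda>i. \<integral>\<^sup>+x. norm (f x - s i x) \<partial>M) \<longlonglongrightarrow> 0"
      "(\<lambda>i. Bochner_Integration.simple_bochner_integral M (s i)) \<longlonglongrightarrow> y"
    using assms(1) unfolding has_bochner_int_def by blast
  obtain t where t: "\<And>i::nat. Bochner_Integration.simple_bochner_integrable M (t i)"
      "(\<lambda>i. \<integral>\<^sup>+x. norm (f x - t i x) \<partial>M) \<longlonglongrightarrow> 0"
      "(\<lambda>i. Bochner_Integration.simple_bochner_integral M (t i)) \<longlonglongrightarrow> z"
    using assms(2) unfolding has_bochner_int_def by blast
  have [measurable]: "(\<lambda>x. norm (f x - s i x)) \<in> borel_measurable M"
      "(\<lambda>x. norm (f x - t i x)) \<in> borel_measurable M" for i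
    using s(1)[of i] t(1)[of i]
    by (simp_all add: strongly_measurable_norm_diff[OF sm] simple_bochner_integrable.simps)
  have le: "ennreal (norm (Bochner_Integration.simple_bochner_integral M (s i) - Bochner_Integration.simple_bochner_integral M (t i))) \<le>
      (\<integral>\<^sup>+ x. norm (f x - s i x) \<partial>M) + (\<integral>\<^sup>+ x. norm (f x - t i x) \<partial>M)" for i
  proof -
    have "ennreal (norm (Bochner_Integration.simple_bochner_integral M (s i) - Bochner_Integration.simple_bochner_integral M (t i)))
        = norm (Bochner_Integration.simple_bochner_integral M (\<lambda>x. s i x - t i x))"
      using s(1) t(1) by (subst simple_bochner_integral_diff) auto
    also have "\<dots> \<le> Bochner_Integration.simple_bochner_integral M (\<lambda>x. norm (s i x - t i x))"
      using simple_bochner_integrable_compose2[of "(-)" M "s i" "t i"] s(1) t(1)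
      by (auto intro!: simple_bochner_integral_norm_bound)
    also have "\<dots> = (\<integral>\<^sup>+x. norm (s i x - t i x) \<partial>M)"
      using simple_bochner_integrable_compose2[of "\<lambda>x y. norm (x - y)" M "s i" "t i"] s(1) t(1)
      by (auto intro!: simple_bochner_integral_eq_nn_integral)
    also have "\<dots> \<le> (\<integral>\<^sup>+x. ennreal (norm (f x - s i x)) + ennreal (norm (f x - t i x)) \<partial>M)"
    proof (rule nn_integral_mono)
      fix x
      have "norm (s i x - t i x) \<le> norm (f x - s i x) + norm (f x - t i x)"
        by (metis dual_order.refl norm_diff_triangle_le norm_minus_commute)
      then show "ennreal (norm (s i x - t i x)) \<le> ennreal (norm (f x - s i x)) + ennreal (norm (f x - t i x))"
        by (metis (mono_tags, lifting) ennreal_leI ennreal_plus norm_ge_zero)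
    qed
    also have "\<dots> = (\<integral>\<^sup>+ x. norm (f x - s i x) \<partial>M) + (\<integral>\<^sup>+ x. norm (f x - t i x) \<partial>M)"
      by (rule nn_integral_add) auto
    finally show ?thesis .
  qed
  have "(\<lambda>i. ennreal (norm (Bochner_Integration.simple_bochner_integral M (s i) - Bochner_Integration.simple_bochner_integral M (t i)))) \<longlonglongrightarrow> 0"
  proof (rule tendsto_sandwich[OF _ always_eventually[OF allI[OF le]] tendsto_const])
    show "(\<lambda>i. (\<integral>\<^sup>+ x. norm (f x - s i x) \<partial>M) + (\<integral>\<^sup>+ x. norm (f x - t i x) \<partial>M)) \<longlonglongrightarrow> 0"
      using tendsto_add[OF s(2) t(2)] by simp
  qed simp
  moreover have "(\<lambda>i. ennreal (norm (Bochner_Integration.simple_bochner_integral M (s i) - Bochner_Integration.simple_bochner_integral M (t i))))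
      \<longlonglongrightarrow> ennreal (norm (y - z))"
    using s(3) t(3) by (intro tendsto_intros)
  ultimately have "ennreal (norm (y - z)) = 0"
    using LIMSEQ_unique by blast
  then show ?thesis
    by simp
qed

lemma has_bochner_int_iff_library:
  fixes f :: "'b \<Rightarrow> 'a::{banach, second_countable_topology}"
  shows "has_bochner_int M f y \<longleftrightarrow> has_bochner_integral M f y"
proof -
  have "strongly_measurable M f \<longleftrightarrow> f \<in> borel_measurable M"
  proof
    assume "strongly_measurable M f"
    then obtain s where "\<And>i::nat. simple_function M (s i)"
        "\<And>x. x \<in> space M \<Longrightarrow> (\<lambda>i. s i x) \<longlonglongrightarrow> f x"
      unfolding strongly_measurable_def by blast
    then show "f \<in> borel_measurable M"
      by (rule borel_measurable_LIMSEQ_metric[OF borel_measurable_simple_function])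
  next
    assume "f \<in> borel_measurable M"
    from borel_measurable_implies_sequence_metric[OF this, of 0]
    obtain F where "\<forall>i. simple_function M (F i)" "\<forall>x\<in>space M. (\<lambda>i. F i x) \<longlonglongrightarrow> f x"
      by (elim exE conjE)
    then show "strongly_measurable M f"
      unfolding strongly_measurable_def by (intro exI[of _ F] conjI)
  qed
  then show ?thesis
    by (simp only: has_bochner_int_def has_bochner_integral.simps ex_simps)
qed

text \<open>
  A function on \<open>[a,b]\<close> is encoded as a function on \<open>\<real>\<close> vanishing outside \<open>[a,b]\<close>, so that the
  function spaces below are linear subspaces of \<open>real \<Rightarrow> 'a\<close> and equality is equality on \<open>[a,b]\<close>.
  Derivatives at the end points are one-sided.
\<close>

definition deriv_on :: "real \<Rightarrow> real \<Rightarrow> (real \<Rightarrow> 'a::real_normed_vector) \<Rightarrow> real \<Rightarrow> 'a" where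
  "deriv_on a b f = (\<lambda>t. if t \<in> {a..b} then vector_derivative f (at t within {a..b}) else 0)"

definition Ck_space :: "real \<Rightarrow> real \<Rightarrow> nat \<Rightarrow> (real \<Rightarrow> 'a::real_normed_vector) set" where
  "Ck_space a b k = {f. (\<forall>t. t \<notin> {a..b} \<longrightarrow> f t = 0) \<and>
     (\<forall>j<k. \<forall>t\<in>{a..b}. (deriv_on a b ^^ j) f differentiable (at t within {a..b})) \<and>
     (\<forall>j\<le>k. continuous_on {a..b} ((deriv_on a b ^^ j) f))}"

definition Ck_norm :: "real \<Rightarrow> real \<Rightarrow> nat \<Rightarrow> (real \<Rightarrow> 'a::real_normed_vector) \<Rightarrow> real" where
  "Ck_norm a b k f = (\<Sum>j\<le>k. SUP t\<in>{a..b}. norm ((deriv_on a b ^^ j) f t))"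

definition test_function :: "real \<Rightarrow> real \<Rightarrow> (real \<Rightarrow> real) \<Rightarrow> bool" where
  "test_function a b \<phi> \<longleftrightarrow>
     (\<forall>n x. (deriv ^^ n) \<phi> field_differentiable (at x)) \<and>
     (\<exists>c d. a < c \<and> d < b \<and> (\<forall>x. x \<notin> {c..d} \<longrightarrow> \<phi> x = 0))"

definition loc_integrable :: "real \<Rightarrow> real \<Rightarrow> (real \<Rightarrow> 'a::banach) \<Rightarrow> bool" where
  "loc_integrable a b u \<longleftrightarrow>
     (\<forall>c d. a < c \<and> c \<le> d \<and> d < b \<longrightarrow> bochner_integrable (lebesgue_on {c..d}) u)"

definition has_weak_deriv ::
    "real \<Rightarrow> real \<Rightarrow> nat \<Rightarrow> (real \<Rightarrow> 'a::banach) \<Rightarrow> (real \<Rightarrow> 'a) \<Rightarrow> bool" where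
  "has_weak_deriv a b n u v \<longleftrightarrow> loc_integrable a b u \<and> loc_integrable a b v \<and>
     (\<forall>\<phi>. test_function a b \<phi> \<longrightarrow>
        bochner_int (lebesgue_on {a..b}) (\<lambda>t. (deriv ^^ n) \<phi> t *\<^sub>R u t) =
        (-1) ^ n *\<^sub>R bochner_int (lebesgue_on {a..b}) (\<lambda>t. \<phi> t *\<^sub>R v t))"

definition RL_integral :: "real \<Rightarrow> real \<Rightarrow> (real \<Rightarrow> 'a::banach) \<Rightarrow> real \<Rightarrow> 'a" where
  "RL_integral a \<gamma> f t = (if \<gamma> = 0 then f t else
     (1 / Gamma \<gamma>) *\<^sub>R bochner_int (lebesgue_on {a..t}) (\<lambda>s. (t - s) powr (\<gamma> - 1) *\<^sub>R f s))"

definition has_RL_deriv ::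
    "real \<Rightarrow> real \<Rightarrow> real \<Rightarrow> (real \<Rightarrow> 'a::banach) \<Rightarrow> (real \<Rightarrow> 'a) \<Rightarrow> bool" where
  "has_RL_deriv a b \<alpha> f v \<longleftrightarrow>
     has_weak_deriv a b (nat \<lceil>\<alpha>\<rceil>) (RL_integral a (of_int \<lceil>\<alpha>\<rceil> - \<alpha>) f) v"

definition has_Caputo_deriv ::
    "real \<Rightarrow> real \<Rightarrow> real \<Rightarrow> (real \<Rightarrow> 'a::banach) \<Rightarrow> (real \<Rightarrow> 'a) \<Rightarrow> bool" where
  "has_Caputo_deriv a b \<alpha> f v \<longleftrightarrow>
     (if \<alpha> \<in> \<nat> then has_weak_deriv a b (nat \<lceil>\<alpha>\<rceil>) f v
      else has_RL_deriv a b \<alpha>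
        (\<lambda>t. f t - (\<Sum>j<nat \<lceil>\<alpha>\<rceil>. ((t - a) ^ j / fact j) *\<^sub>R (deriv_on a b ^^ j) f a)) v)"

text \<open>
  The continuous representatives on \<open>[a,b]\<close> of the weakly defined fractional derivatives.
\<close>

definition RL_deriv :: "real \<Rightarrow> real \<Rightarrow> real \<Rightarrow> (real \<Rightarrow> 'a::banach) \<Rightarrow> real \<Rightarrow> 'a" where
  "RL_deriv a b \<alpha> f = (THE v. v \<in> Ck_space a b 0 \<and> has_RL_deriv a b \<alpha> f v)"

definition Caputo_deriv :: "real \<Rightarrow> real \<Rightarrow> real \<Rightarrow> (real \<Rightarrow> 'a::banach) \<Rightarrow> real \<Rightarrow> 'a" where
  "Caputo_deriv a b \<alpha> f = (THE v. v \<in> Ck_space a b 0 \<and> has_Caputo_deriv a b \<alpha> f v)"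

definition RL_space :: "real \<Rightarrow> real \<Rightarrow> real \<Rightarrow> (real \<Rightarrow> 'a::banach) set" where
  "RL_space a b \<alpha> =
     {f \<in> Ck_space a b (nat \<lceil>\<alpha>\<rceil> - 1). \<exists>v \<in> Ck_space a b 0. has_RL_deriv a b \<alpha> f v}"

definition RL_norm :: "real \<Rightarrow> real \<Rightarrow> real \<Rightarrow> (real \<Rightarrow> 'a::banach) \<Rightarrow> real" where
  "RL_norm a b \<alpha> f = Ck_norm a b (nat \<lceil>\<alpha>\<rceil> - 1) f + Ck_norm a b 0 (RL_deriv a b \<alpha> f)"

definition Caputo_space :: "real \<Rightarrow> real \<Rightarrow> real \<Rightarrow> (real \<Rightarrow> 'a::banach) set" where
  "Caputo_space a b \<alpha> =
     {f \<in> Ck_space a b (nat \<lceil>\<alpha>\<rceil> - 1). \<exists>v \<in> Ck_space a b 0. has_Caputo_deriv a b \<alpha> f v}"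

definition Caputo_norm :: "real \<Rightarrow> real \<Rightarrow> real \<Rightarrow> (real \<Rightarrow> 'a::banach) \<Rightarrow> real" where
  "Caputo_norm a b \<alpha> f = Ck_norm a b (nat \<lceil>\<alpha>\<rceil> - 1) f + Ck_norm a b 0 (Caputo_deriv a b \<alpha> f)"

definition continuously_embedded :: "'v set \<Rightarrow> ('v \<Rightarrow> real) \<Rightarrow> 'v set \<Rightarrow> ('v \<Rightarrow> real) \<Rightarrow> bool" where
  "continuously_embedded E normE F normF \<longleftrightarrow>
     E \<subseteq> F \<and> (\<exists>C. \<forall>f\<in>E. normF f \<le> C * normE f)"

end

theory Submission
  imports Defs
begin

text \<open>
  For \<open>\<alpha> \<in> \<nat>\<close> the two derivatives coincide. For \<open>\<alpha> \<notin> \<nat>\<close> put \<open>n = \<lceil>\<alpha>\<rceil>\<close> and \<open>\<gamma> = n - \<alpha> \<in> (0,1)\<close>. The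
  point is that \<open>f \<in> RL\<^sup>\<alpha>\<close> forces \<open>f\<^sup>(\<^sup>j\<^sup>)(t\<^sub>0) = 0\<close> for all \<open>j < n\<close>, so that the Taylor polynomial in the
  Caputo derivative vanishes and the embedding is isometric; nonzero constants lie in \<open>C\<^sup>\<alpha>\<close> but violate
  this condition. If \<open>j\<close> is minimal with \<open>f\<^sup>(\<^sup>j\<^sup>)(t\<^sub>0) \<noteq> 0\<close>, then \<open>J\<^sup>\<gamma> f(t) = c (t - t\<^sub>0)\<^sup>\<beta> + o((t - t\<^sub>0)\<^sup>\<beta>)\<close> with
  \<open>\<beta> = j + \<gamma>\<close> and \<open>c \<noteq> 0\<close>. Testing the weak derivative \<open>v\<close> against the rescaled bump \<open>\<phi>((t - t\<^sub>0)/\<epsilon>)\<close> with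
  \<open>\<phi>\<close> supported in \<open>[1,2]\<close> gives \<open>\<epsilon>\<^sup>1\<^sup>-\<^sup>n\<^sup>+\<^sup>\<beta> (m c + o(1)) = O(\<epsilon>)\<close>, where \<open>m = \<integral> \<phi>\<^sup>(\<^sup>n\<^sup>)(r) r\<^sup>\<beta> dr\<close> is nonzero
  by integration by parts because \<open>\<beta> \<notin> \<int>\<close>. As \<open>\<beta> < n\<close>, this is impossible for small \<open>\<epsilon>\<close>.
\<close>

subsection \<open>Bochner integrals in nonseparable Banach spaces\<close>

lemma strongly_measurable_compose2:
  fixes f :: "'b \<Rightarrow> 'c::real_normed_vector" and g :: "'b \<Rightarrow> 'd::real_normed_vector"
    and h :: "'c \<Rightarrow> 'd \<Rightarrow> 'e::real_normed_vector"
  assumes "strongly_measurable M f" "strongly_measurable M g"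
    and h: "continuous_on UNIV (\<lambda>p. h (fst p) (snd p))"
  shows "strongly_measurable M (\<lambda>x. h (f x) (g x))"
proof -
  obtain r where r: "\<And>i::nat. simple_function M (r i)"
      "\<And>x. x \<in> space M \<Longrightarrow> (\<lambda>i. r i x) \<longlonglongrightarrow> f x"
    using assms(1) unfolding strongly_measurable_def by blast
  obtain s where s: "\<And>i::nat. simple_function M (s i)"
      "\<And>x. x \<in> space M \<Longrightarrow> (\<lambda>i. s i x) \<longlonglongrightarrow> g x"
    using assms(2) unfolding strongly_measurable_def by blast
  show ?thesis
    unfolding strongly_measurable_def
  proof (intro exI[of _ "\<lambda>i x. h (r i x) (s i x)"] conjI allI ballI)
    show "simple_function M (\<lambda>x. h (r i x) (s i x))" for i
      by (rule simple_function_compose2[OF r(1) s(1)])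
    fix x assume x: "x \<in> space M"
    have "(\<lambda>i. (r i x, s i x)) \<longlonglongrightarrow> (f x, g x)"
      using r(2)[OF x] s(2)[OF x] by (intro tendsto_intros)
    from continuous_on_tendsto_compose[OF h this]
    show "(\<lambda>i. h (r i x) (s i x)) \<longlonglongrightarrow> h (f x) (g x)"
      by simp
  qed
qed

lemma strongly_measurable_diff:
  "strongly_measurable M f \<Longrightarrow> strongly_measurable M g \<Longrightarrow> strongly_measurable M (\<lambda>x. f x - g x)"
  by (rule strongly_measurable_compose2) (auto intro!: continuous_intros)

lemma strongly_measurable_scaleR:
  "strongly_measurable M f \<Longrightarrow> strongly_measurable M g \<Longrightarrow> strongly_measurable M (\<lambda>x. f x *\<^sub>R g x)"
  by (rule strongly_measurable_compose2) (auto intro!: continuous_intros)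

lemma strongly_measurable_const: "strongly_measurable M (\<lambda>x. c)"
  unfolding strongly_measurable_def by (intro exI[of _ "\<lambda>i x. c"]) auto

lemma borel_measurable_imp_strongly_measurable:
  fixes f :: "'b \<Rightarrow> 'a::{banach, second_countable_topology}"
  assumes "f \<in> borel_measurable M"
  shows "strongly_measurable M f"
proof -
  from borel_measurable_implies_sequence_metric[OF assms, of 0]
  obtain F where "\<forall>i. simple_function M (F i)" "\<forall>x\<in>space M. (\<lambda>i. F i x) \<longlonglongrightarrow> f x"
    by (elim exE conjE)
  then show "strongly_measurable M f"
    unfolding strongly_measurable_def by (intro exI[of _ F] conjI)
qed

lemma strongly_measurable_cong:
  "(\<And>x. x \<in> space M \<Longrightarrow> f x = g x) \<Longrightarrow> strongly_measurable M f \<longleftrightarrow> strongly_measurable M g"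
  by (simp add: strongly_measurable_def cong: conj_cong ball_cong)

text \<open>Multiplying the approximating simple functions by the indicator of \<open>A\<close>
  keeps them simple and convergent. This carries local information on a compact subinterval over to
  the whole interval when a test function vanishes off that subinterval.\<close>

lemma strongly_measurable_extend:
  fixes u :: "real \<Rightarrow> 'a::real_normed_vector"
  assumes u: "strongly_measurable (lebesgue_on A) u" and "A \<in> sets lebesgue" "B \<in> sets lebesgue"
    and "A \<subseteq> B"
  shows "strongly_measurable (lebesgue_on B) (\<lambda>x. indicator A x *\<^sub>R u x)"
proof -
  obtain s where s: "\<And>i::nat. simple_function (lebesgue_on A) (s i)"
      "\<And>x. x \<in> A \<Longrightarrow> (\<lambda>i. s i x) \<longlonglongrightarrow> u x"
    using u unfolding strongly_measurable_def by auto
  show ?thesis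
    unfolding strongly_measurable_def
  proof (intro exI[of _ "\<lambda>i x. indicator A x *\<^sub>R s i x"] conjI allI ballI)
    have "(\<lambda>x. (indicat_real B x * indicat_real A x) *\<^sub>R s i x) = (\<lambda>x. indicat_real A x *\<^sub>R s i x)" for i
      using \<open>A \<subseteq> B\<close> by (auto simp: fun_eq_iff indicator_def)
    then show "simple_function (lebesgue_on B) (\<lambda>x. indicator A x *\<^sub>R s i x)" for i
      using s(1)[of i] assms by (simp add: simple_function_restrict_space del: mult_eq_0_iff mult_cancel_right1 mult_cancel_right2)
    show "(\<lambda>i. indicator A x *\<^sub>R s i x) \<longlonglongrightarrow> indicator A x *\<^sub>R u x" for x
      using s(2)[of x] by (auto simp: indicator_def)
  qed
qed

text \<open>The approximants sample \<open>f\<close> at x rounded down to a multiple of 1/(i + 1).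
  On a bounded interval this uses finitely many sample points, and continuity gives convergence.
  Rounding down can fall below \<open>a\<close>, hence the maximum with \<open>a\<close>.\<close>

lemma strongly_measurable_continuous_on:
  fixes f :: "real \<Rightarrow> 'a::real_normed_vector"
  assumes f: "continuous_on {a..b} f"
  shows "strongly_measurable (lebesgue_on {a..b}) f"
  unfolding strongly_measurable_def
proof (intro exI[of _ "\<lambda>i x. f (max a (\<lfloor>x * real (Suc i)\<rfloor> / real (Suc i)))"] conjI allI ballI)
  fix i
  let ?g = "\<lambda>x::real. \<lfloor>x * real (Suc i)\<rfloor>"
  have "simple_function (lebesgue_on {a..b}) ?g"
    unfolding simple_function_def
  proof (intro conjI ballI)
    have "?g ` space (lebesgue_on {a..b}) \<subseteq> {?g a..?g b}"
      by (auto intro!: floor_mono mult_right_mono)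
    then show "finite (?g ` space (lebesgue_on {a..b}))"
      by (rule finite_subset) simp
    show "?g -` {k} \<inter> space (lebesgue_on {a..b}) \<in> sets (lebesgue_on {a..b})" for k
    proof -
      have "?g -` {k} \<in> sets borel"
      proof -
        have "?g \<in> measurable borel (count_space UNIV)" by measurable
        from measurable_sets[OF this, of "{k}"] show ?thesis by simp
      qed
      then have "?g -` {k} \<in> sets lebesgue" by auto
      then show ?thesis
        by (auto simp: sets_restrict_space)
    qed
  qed
  then show "simple_function (lebesgue_on {a..b}) (\<lambda>x. f (max a (?g x / real (Suc i))))"
    by (rule simple_function_compose1)
next
  fix x assume "x \<in> space (lebesgue_on {a..b})"
  then have x: "x \<in> {a..b}" by simp
  have fl: "(\<lambda>i. \<lfloor>x * real (Suc i)\<rfloor> / real (Suc i)) \<longlonglongrightarrow> x"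
  proof (rule tendsto_sandwich[of "\<lambda>i. x - 1 / real (Suc i)" _ _ "\<lambda>i. x"])
    have "(\<lambda>i. x - 1 / real (Suc i)) \<longlonglongrightarrow> x - 0"
      by (intro tendsto_intros LIMSEQ_Suc lim_1_over_n)
    then show "(\<lambda>i. x - 1 / real (Suc i)) \<longlonglongrightarrow> x" by simp
    show "\<forall>\<^sub>F i in sequentially. x - 1 / real (Suc i) \<le> \<lfloor>x * real (Suc i)\<rfloor> / real (Suc i)"
    proof (intro always_eventually allI)
      fix i
      have "x * real (Suc i) - 1 \<le> \<lfloor>x * real (Suc i)\<rfloor>" by linarith
      then have "(x * real (Suc i) - 1) / real (Suc i) \<le> \<lfloor>x * real (Suc i)\<rfloor> / real (Suc i)"
        by (rule divide_right_mono) simp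
      then show "x - 1 / real (Suc i) \<le> \<lfloor>x * real (Suc i)\<rfloor> / real (Suc i)"
        by (simp add: diff_divide_distrib del: of_nat_Suc)
    qed
    show "\<forall>\<^sub>F i in sequentially. \<lfloor>x * real (Suc i)\<rfloor> / real (Suc i) \<le> x"
      by (intro always_eventually allI) (simp add: pos_divide_le_eq del: of_nat_Suc)
  qed simp
  have lim: "(\<lambda>i. max a (\<lfloor>x * real (Suc i)\<rfloor> / real (Suc i))) \<longlonglongrightarrow> x"
    using tendsto_max[OF tendsto_const[of a] fl] x by (simp add: max_def)
  have "max a (\<lfloor>x * real (Suc i)\<rfloor> / real (Suc i)) \<in> {a..b}" for i
  proof -
    have "\<lfloor>x * real (Suc i)\<rfloor> / real (Suc i) \<le> x" by (simp add: pos_divide_le_eq del: of_nat_Suc)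
    then show ?thesis using x by auto
  qed
  then show "(\<lambda>i. f (max a (\<lfloor>x * real (Suc i)\<rfloor> / real (Suc i)))) \<longlonglongrightarrow> f x"
    by (intro continuous_on_tendsto_compose[OF f lim x]) auto
qed

section \<open>Norm estimates, linearity and existence of the Bochner integral\<close>

lemma has_bochner_intD:
  assumes "has_bochner_int M f y"
  obtains s where "strongly_measurable M f"
    and "\<And>i::nat. Bochner_Integration.simple_bochner_integrable M (s i)"
    and "(\<lambda>i. \<integral>\<^sup>+x. norm (f x - s i x) \<partial>M) \<longlonglongrightarrow> 0"
    and "(\<lambda>i. Bochner_Integration.simple_bochner_integral M (s i)) \<longlonglongrightarrow> y"
    and "\<And>i. (\<lambda>x. norm (f x - s i x)) \<in> borel_measurable M"
proof -
  from assms obtain s where sm: "strongly_measurable M f"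
    and s: "\<forall>i::nat. Bochner_Integration.simple_bochner_integrable M (s i)"
      "(\<lambda>i. \<integral>\<^sup>+x. norm (f x - s i x) \<partial>M) \<longlonglongrightarrow> 0"
      "(\<lambda>i. Bochner_Integration.simple_bochner_integral M (s i)) \<longlonglongrightarrow> y"
    unfolding has_bochner_int_def by (elim conjE exE)
  have "(\<lambda>x. norm (f x - s i x)) \<in> borel_measurable M" for i
    using s(1) by (intro strongly_measurable_norm_diff[OF sm]) (simp add: simple_bochner_integrable.simps)
  then show thesis by (rule that[OF sm s(1)[rule_format] s(2,3)])
qed

lemma has_bochner_int_norm_le:
  assumes "has_bochner_int M f y"
  shows "ennreal (norm y) \<le> (\<integral>\<^sup>+x. norm (f x) \<partial>M)"
proof -
  obtain s where sm: "strongly_measurable M f"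
    and s: "\<And>i::nat. Bochner_Integration.simple_bochner_integrable M (s i)"
      "(\<lambda>i. \<integral>\<^sup>+x. norm (f x - s i x) \<partial>M) \<longlonglongrightarrow> 0"
      "(\<lambda>i. Bochner_Integration.simple_bochner_integral M (s i)) \<longlonglongrightarrow> y"
    and [measurable]: "\<And>i. (\<lambda>x. norm (f x - s i x)) \<in> borel_measurable M"
    using assms by (rule has_bochner_intD) (rule that)
  have [measurable]: "(\<lambda>x. norm (f x)) \<in> borel_measurable M"
    using strongly_measurable_norm_diff[OF sm, of "\<lambda>x. 0"] by simp
  have le: "ennreal (norm (Bochner_Integration.simple_bochner_integral M (s i))) \<le>
      (\<integral>\<^sup>+ x. norm (f x) \<partial>M) + (\<integral>\<^sup>+ x. norm (f x - s i x) \<partial>M)" for i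
  proof -
    have "ennreal (norm (Bochner_Integration.simple_bochner_integral M (s i)))
        \<le> Bochner_Integration.simple_bochner_integral M (\<lambda>x. norm (s i x))"
      by (intro ennreal_leI simple_bochner_integral_norm_bound s)
    also have "\<dots> = (\<integral>\<^sup>+x. norm (s i x) \<partial>M)"
      using simple_bochner_integrable_compose2[of "\<lambda>x y. norm x" M "s i" "s i"] s(1)
      by (auto intro!: simple_bochner_integral_eq_nn_integral)
    also have "\<dots> \<le> (\<integral>\<^sup>+x. ennreal (norm (f x)) + ennreal (norm (f x - s i x)) \<partial>M)"
    proof (rule nn_integral_mono)
      fix x
      have "norm (s i x) \<le> norm (f x) + norm (f x - s i x)"
        using norm_triangle_ineq4[of "f x" "f x - s i x"] by simp
      then show "ennreal (norm (s i x)) \<le> ennreal (norm (f x)) + ennreal (norm (f x - s i x))"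
        by (metis (mono_tags, lifting) ennreal_leI ennreal_plus norm_ge_zero)
    qed
    also have "\<dots> = (\<integral>\<^sup>+ x. norm (f x) \<partial>M) + (\<integral>\<^sup>+ x. norm (f x - s i x) \<partial>M)"
      by (rule nn_integral_add) auto
    finally show ?thesis .
  qed
  show ?thesis
  proof (rule LIMSEQ_le)
    show "(\<lambda>i. ennreal (norm (Bochner_Integration.simple_bochner_integral M (s i)))) \<longlonglongrightarrow> ennreal (norm y)"
      using s(3) by (intro tendsto_intros)
    show "(\<lambda>i. (\<integral>\<^sup>+ x. norm (f x) \<partial>M) + (\<integral>\<^sup>+ x. norm (f x - s i x) \<partial>M)) \<longlonglongrightarrow> (\<integral>\<^sup>+ x. norm (f x) \<partial>M)"
      using tendsto_add[OF tendsto_const s(2)] by simp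
  qed (use le in blast)
qed

lemma has_bochner_int_diff:
  assumes "has_bochner_int M f y" "has_bochner_int M g z"
  shows "has_bochner_int M (\<lambda>x. f x - g x) (y - z)"
proof -
  obtain s where sm: "strongly_measurable M f"
    and s: "\<And>i::nat. Bochner_Integration.simple_bochner_integrable M (s i)"
      "(\<lambda>i. \<integral>\<^sup>+x. norm (f x - s i x) \<partial>M) \<longlonglongrightarrow> 0"
      "(\<lambda>i. Bochner_Integration.simple_bochner_integral M (s i)) \<longlonglongrightarrow> y"
    and [measurable]: "\<And>i. (\<lambda>x. norm (f x - s i x)) \<in> borel_measurable M"
    using assms(1) by (rule has_bochner_intD) (rule that)
  obtain t where tm: "strongly_measurable M g"
    and t: "\<And>i::nat. Bochner_Integration.simple_bochner_integrable M (t i)"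
      "(\<lambda>i. \<integral>\<^sup>+x. norm (g x - t i x) \<partial>M) \<longlonglongrightarrow> 0"
      "(\<lambda>i. Bochner_Integration.simple_bochner_integral M (t i)) \<longlonglongrightarrow> z"
    and [measurable]: "\<And>i. (\<lambda>x. norm (g x - t i x)) \<in> borel_measurable M"
    using assms(2) by (rule has_bochner_intD) (rule that)
  have le: "(\<integral>\<^sup>+x. norm (f x - g x - (s i x - t i x)) \<partial>M) \<le>
      (\<integral>\<^sup>+ x. norm (f x - s i x) \<partial>M) + (\<integral>\<^sup>+ x. norm (g x - t i x) \<partial>M)" for i
  proof -
    have "(\<integral>\<^sup>+x. norm (f x - g x - (s i x - t i x)) \<partial>M) \<le>
        (\<integral>\<^sup>+x. ennreal (norm (f x - s i x)) + ennreal (norm (g x - t i x)) \<partial>M)"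
    proof (rule nn_integral_mono)
      fix x
      have "norm (f x - g x - (s i x - t i x)) \<le> norm (f x - s i x) + norm (g x - t i x)"
        using norm_triangle_ineq4[of "f x - s i x" "g x - t i x"] by (simp add: algebra_simps)
      then show "ennreal (norm (f x - g x - (s i x - t i x)))
          \<le> ennreal (norm (f x - s i x)) + ennreal (norm (g x - t i x))"
        by (metis (mono_tags, lifting) ennreal_leI ennreal_plus norm_ge_zero)
    qed
    also have "\<dots> = (\<integral>\<^sup>+ x. norm (f x - s i x) \<partial>M) + (\<integral>\<^sup>+ x. norm (g x - t i x) \<partial>M)"
      by (rule nn_integral_add) auto
    finally show ?thesis .
  qed
  show ?thesis
    unfolding has_bochner_int_def
  proof (intro conjI exI[of _ "\<lambda>i x. s i x - t i x"] allI)
    show "strongly_measurable M (\<lambda>x. f x - g x)"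
      by (rule strongly_measurable_diff[OF sm tm])
    show "Bochner_Integration.simple_bochner_integrable M (\<lambda>x. s i x - t i x)" for i
      using simple_bochner_integrable_compose2[of "(-)" M "s i" "t i"] s(1) t(1) by simp
    show "(\<lambda>i. \<integral>\<^sup>+x. norm (f x - g x - (s i x - t i x)) \<partial>M) \<longlonglongrightarrow> 0"
    proof (rule tendsto_sandwich[OF _ always_eventually[OF allI[OF le]] tendsto_const])
      show "(\<lambda>i. (\<integral>\<^sup>+ x. norm (f x - s i x) \<partial>M) + (\<integral>\<^sup>+ x. norm (g x - t i x) \<partial>M)) \<longlonglongrightarrow> 0"
        using tendsto_add[OF s(2) t(2)] by simp
    qed simp
    show "(\<lambda>i. Bochner_Integration.simple_bochner_integral M (\<lambda>x. s i x - t i x)) \<longlonglongrightarrow> y - z"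
      using tendsto_diff[OF s(3) t(3)] s(1) t(1) by (simp add: simple_bochner_integral_diff)
  qed
qed

text \<open>Simple functions approximating \<open>h\<close> in the mean, multiplied by
  \<open>z\<close>, approximate the vector-valued integrand. The lemma imports explicit scalar
  integrals into the vector-valued setting.\<close>

lemma has_bochner_int_scaleR_left:
  fixes h :: "'b \<Rightarrow> real" and z :: "'a::banach"
  assumes "has_bochner_integral M h c"
  shows "has_bochner_int M (\<lambda>x. h x *\<^sub>R z) (c *\<^sub>R z)"
proof -
  have "has_bochner_int M h c" using assms by (simp add: has_bochner_int_iff_library)
  then obtain s where sm: "strongly_measurable M h"
    and s: "\<And>i::nat. Bochner_Integration.simple_bochner_integrable M (s i)"
      "(\<lambda>i. \<integral>\<^sup>+x. norm (h x - s i x) \<partial>M) \<longlonglongrightarrow> 0"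
      "(\<lambda>i. Bochner_Integration.simple_bochner_integral M (s i)) \<longlonglongrightarrow> c"
    and [measurable]: "\<And>i. (\<lambda>x. norm (h x - s i x)) \<in> borel_measurable M"
    by (rule has_bochner_intD) (rule that)
  show ?thesis
    unfolding has_bochner_int_def
  proof (intro conjI exI[of _ "\<lambda>i x. s i x *\<^sub>R z"] allI)
    show "strongly_measurable M (\<lambda>x. h x *\<^sub>R z)"
      by (rule strongly_measurable_scaleR[OF sm strongly_measurable_const])
    show "Bochner_Integration.simple_bochner_integrable M (\<lambda>x. s i x *\<^sub>R z)" for i
      using simple_bochner_integrable_compose2[of "\<lambda>u v. u *\<^sub>R z" M "s i" "s i"] s(1) by simp
    have "(\<integral>\<^sup>+x. norm (h x *\<^sub>R z - s i x *\<^sub>R z) \<partial>M) = ennreal (norm z) * (\<integral>\<^sup>+x. norm (h x - s i x) \<partial>M)" for i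
    proof -
      have "ennreal (norm (h x *\<^sub>R z - s i x *\<^sub>R z)) = ennreal (norm z) * ennreal (norm (h x - s i x))" for x
        by (metis ennreal_mult' mult.commute norm_ge_zero norm_scaleR real_norm_def scaleR_diff_left)
      then show ?thesis by (simp add: nn_integral_cmult del: real_norm_def)
    qed
    then show "(\<lambda>i. \<integral>\<^sup>+x. norm (h x *\<^sub>R z - s i x *\<^sub>R z) \<partial>M) \<longlonglongrightarrow> 0"
      using ennreal_tendsto_cmult[OF _ s(2), of "ennreal (norm z)"] by (simp del: real_norm_def)
    have "linear (\<lambda>r::real. r *\<^sub>R z)" by (simp add: linear_iff scaleR_left_distrib)
    then have "Bochner_Integration.simple_bochner_integral M (\<lambda>x. s i x *\<^sub>R z)
        = Bochner_Integration.simple_bochner_integral M (s i) *\<^sub>R z" for i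
      using simple_bochner_integral_linear[of "\<lambda>r::real. r *\<^sub>R z" M "s i"] s(1) by simp
    then show "(\<lambda>i. Bochner_Integration.simple_bochner_integral M (\<lambda>x. s i x *\<^sub>R z)) \<longlonglongrightarrow> c *\<^sub>R z"
      using tendsto_scaleR[OF s(3) tendsto_const[of z]] by simp
  qed
qed

text \<open>Dominated convergence makes truncated simple approximants converge to \<open>f\<close>
  in the mean. Their integrals are then Cauchy, and completeness of the target space supplies the
  value of the integral.\<close>

lemma bochner_integrableI_bounded:
  fixes f :: "'b \<Rightarrow> 'a::banach"
  assumes sm: "strongly_measurable M f" and fin: "(\<integral>\<^sup>+x. norm (f x) \<partial>M) < \<infinity>"
  shows "bochner_integrable M f"
proof -
  obtain r where r: "\<And>i::nat. simple_function M (r i)"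
      "\<And>x. x \<in> space M \<Longrightarrow> (\<lambda>i. r i x) \<longlonglongrightarrow> f x"
    using sm unfolding strongly_measurable_def by blast
  have [measurable]: "(\<lambda>x. norm (f x)) \<in> borel_measurable M"
    using strongly_measurable_norm_diff[OF sm, of "\<lambda>x. 0"] by simp
  have [measurable]: "(\<lambda>x. norm (r i x)) \<in> borel_measurable M" for i
    by (intro borel_measurable_simple_function simple_function_compose1[OF r(1)])
  \<comment> \<open>Truncation makes the approximating sequence dominated by \<open>2 \<parallel>f\<parallel>\<close>.\<close>
  define s where "s i x = (if norm (r i x) \<le> 2 * norm (f x) then r i x else 0)" for i x
  have s_simple: "simple_function M (s i)" for i
    unfolding s_def by (intro simple_function_If r simple_function_const) measurable
  have s_le: "norm (s i x) \<le> 2 * norm (f x)" for i x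
    by (simp add: s_def)
  have s_lim: "(\<lambda>i. s i x) \<longlonglongrightarrow> f x" if x: "x \<in> space M" for x
  proof (cases "f x = 0")
    case True
    then have "s i x = 0" for i by (simp add: s_def)
    then show ?thesis using True by simp
  next
    case False
    \<comment> \<open>Where \<open>f x\<close> is nonzero, the truncation threshold lies strictly
      above the limit of the norms, so the truncation is eventually inactive.\<close>
    have "\<forall>\<^sub>F i in sequentially. norm (r i x) < 2 * norm (f x)"
      by (rule order_tendstoD[OF tendsto_norm[OF r(2)[OF x]]]) (use False in simp)
    then have "\<forall>\<^sub>F i in sequentially. r i x = s i x"
      by eventually_elim (simp add: s_def)
    then show ?thesis using r(2)[OF x] by (rule Lim_transform_eventually[rotated])
  qed
  have s_int: "Bochner_Integration.simple_bochner_integrable M (s i)" for i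
  proof (rule simple_bochner_integrableI_bounded[OF s_simple])
    have "(\<integral>\<^sup>+x. norm (s i x) \<partial>M) \<le> (\<integral>\<^sup>+x. 2 * ennreal (norm (f x)) \<partial>M)"
      using s_le[of i] by (intro nn_integral_mono) (simp add: ennreal_mult'[symmetric] flip: ennreal_numeral)
    also have "\<dots> = 2 * (\<integral>\<^sup>+x. norm (f x) \<partial>M)" by (rule nn_integral_cmult) measurable
    also have "\<dots> < \<infinity>" using fin by (simp add: ennreal_mult_less_top)
    finally show "(\<integral>\<^sup>+x. norm (s i x) \<partial>M) < \<infinity>" .
  qed
  have [measurable]: "(\<lambda>x. norm (f x - s i x)) \<in> borel_measurable M" for i
    by (rule strongly_measurable_norm_diff[OF sm s_simple])
  have L1: "(\<lambda>i. \<integral>\<^sup>+x. norm (f x - s i x) \<partial>M) \<longlonglongrightarrow> 0"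
  proof -
    have "(\<lambda>i. \<integral>\<^sup>+x. norm (f x - s i x) \<partial>M) \<longlonglongrightarrow> (\<integral>\<^sup>+x. 0 \<partial>M)"
    proof (rule nn_integral_dominated_convergence[where w = "\<lambda>x. 3 * ennreal (norm (f x))"])
      have "norm (f x - s i x) \<le> 3 * norm (f x)" for i x
        using s_le[of i x] norm_triangle_ineq4[of "f x" "s i x"] by simp
      then show "AE x in M. ennreal (norm (f x - s i x)) \<le> 3 * ennreal (norm (f x))" for i
        by (simp add: ennreal_mult'[symmetric] flip: ennreal_numeral)
      have "(\<integral>\<^sup>+x. 3 * ennreal (norm (f x)) \<partial>M) = 3 * (\<integral>\<^sup>+x. norm (f x) \<partial>M)"
        by (rule nn_integral_cmult) measurable
      also have "\<dots> < \<infinity>" using fin by (simp add: ennreal_mult_less_top)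
      finally show "(\<integral>\<^sup>+x. 3 * ennreal (norm (f x)) \<partial>M) < \<infinity>" .
      show "AE x in M. (\<lambda>i. ennreal (norm (f x - s i x))) \<longlonglongrightarrow> 0"
      proof (rule AE_I2)
        fix x assume "x \<in> space M"
        then have "(\<lambda>i. ennreal (norm (f x - s i x))) \<longlonglongrightarrow> ennreal (norm (f x - f x))"
          by (intro tendsto_intros s_lim)
        then show "(\<lambda>i. ennreal (norm (f x - s i x))) \<longlonglongrightarrow> 0" by simp
      qed
    qed auto
    then show ?thesis by simp
  qed
  let ?S = "\<lambda>i. Bochner_Integration.simple_bochner_integral M (s i)"
  have dist_le: "ennreal (norm (?S i - ?S j)) \<le>
      (\<integral>\<^sup>+ x. norm (f x - s i x) \<partial>M) + (\<integral>\<^sup>+ x. norm (f x - s j x) \<partial>M)" for i j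
  proof -
    have d: "Bochner_Integration.simple_bochner_integrable M (\<lambda>x. s i x - s j x)"
      using simple_bochner_integrable_compose2[of "(-)" M "s i" "s j"] s_int by simp
    have "ennreal (norm (?S i - ?S j))
        = norm (Bochner_Integration.simple_bochner_integral M (\<lambda>x. s i x - s j x))"
      using s_int by (subst simple_bochner_integral_diff) auto
    also have "\<dots> \<le> Bochner_Integration.simple_bochner_integral M (\<lambda>x. norm (s i x - s j x))"
      by (intro ennreal_leI simple_bochner_integral_norm_bound d)
    also have "\<dots> = (\<integral>\<^sup>+x. norm (s i x - s j x) \<partial>M)"
      using simple_bochner_integrable_compose2[of "\<lambda>x y. norm (x - y)" M "s i" "s j"] s_int
      by (auto intro!: simple_bochner_integral_eq_nn_integral)
    also have "\<dots> \<le> (\<integral>\<^sup>+x. ennreal (norm (f x - s i x)) + ennreal (norm (f x - s j x)) \<partial>M)"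
    proof (rule nn_integral_mono)
      fix x
      have "norm (s i x - s j x) \<le> norm (f x - s i x) + norm (f x - s j x)"
        by (metis dual_order.refl norm_diff_triangle_le norm_minus_commute)
      then show "ennreal (norm (s i x - s j x)) \<le> ennreal (norm (f x - s i x)) + ennreal (norm (f x - s j x))"
        by (metis (mono_tags, lifting) ennreal_leI ennreal_plus norm_ge_zero)
    qed
    also have "\<dots> = (\<integral>\<^sup>+ x. norm (f x - s i x) \<partial>M) + (\<integral>\<^sup>+ x. norm (f x - s j x) \<partial>M)"
      by (rule nn_integral_add) auto
    finally show ?thesis .
  qed
  have "Cauchy ?S"
  proof (rule metric_CauchyI)
    fix e :: real assume "e > 0"
    then have "ennreal (e / 2) > 0" by simp
    from order_tendstoD(2)[OF L1 this] obtain N where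
      N: "\<And>i. i \<ge> N \<Longrightarrow> (\<integral>\<^sup>+ x. norm (f x - s i x) \<partial>M) < ennreal (e / 2)"
      unfolding eventually_sequentially by blast
    have "dist (?S i) (?S j) < e" if "i \<ge> N" "j \<ge> N" for i j
    proof -
      have "ennreal (norm (?S i - ?S j)) < ennreal (e / 2) + ennreal (e / 2)"
        by (rule le_less_trans[OF dist_le add_strict_mono[OF N[OF that(1)] N[OF that(2)]]])
      also have "\<dots> = ennreal e" using \<open>e > 0\<close> by (simp flip: ennreal_plus)
      finally show ?thesis using \<open>e > 0\<close> by (simp add: dist_norm ennreal_less_iff)
    qed
    then show "\<exists>N. \<forall>i\<ge>N. \<forall>j\<ge>N. dist (?S i) (?S j) < e" by blast
  qed
  then obtain y where "?S \<longlonglongrightarrow> y" using Cauchy_convergent convergent_def by blast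
  then have "has_bochner_int M f y"
    unfolding has_bochner_int_def using sm s_int L1 by blast
  then show ?thesis by (auto simp: bochner_integrable_def)
qed

lemma bochner_int_eq: "has_bochner_int M f y \<Longrightarrow> bochner_int M f = y"
  unfolding bochner_int_def bochner_integrable_def
  by (auto intro!: the_equality dest: has_bochner_int_unique)

lemma has_bochner_int_bochner_int: "bochner_integrable M f \<Longrightarrow> has_bochner_int M f (bochner_int M f)"
  unfolding bochner_integrable_def using bochner_int_eq by metis

lemma bochner_integrable_bound:
  fixes f :: "'b \<Rightarrow> 'a::banach" and h :: "'b \<Rightarrow> real"
  assumes "strongly_measurable M f" "integrable M h" "\<And>x. x \<in> space M \<Longrightarrow> norm (f x) \<le> h x"
  shows "bochner_integrable M f"
proof (rule bochner_integrableI_bounded[OF assms(1)])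
  have "(\<integral>\<^sup>+x. norm (f x) \<partial>M) \<le> (\<integral>\<^sup>+x. norm (h x) \<partial>M)"
  proof (intro nn_integral_mono ennreal_leI)
    show "norm (f x) \<le> norm (h x)" if "x \<in> space M" for x
      using assms(3)[OF that] norm_ge_zero[of "f x"] by simp
  qed
  also have "\<dots> < \<infinity>" using assms(2) by (simp add: integrable_iff_bounded)
  finally show "(\<integral>\<^sup>+x. norm (f x) \<partial>M) < \<infinity>" .
qed

lemma has_bochner_int_norm_bound:
  fixes f :: "'b \<Rightarrow> 'a::banach" and h :: "'b \<Rightarrow> real"
  assumes f: "has_bochner_int M f y" and h: "has_bochner_integral M h c"
    and le: "\<And>x. x \<in> space M \<Longrightarrow> norm (f x) \<le> h x"
  shows "norm y \<le> c"
proof -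
  have h0: "0 \<le> h x" if "x \<in> space M" for x
    by (rule order_trans[OF norm_ge_zero le[OF that]])
  have "ennreal (norm y) \<le> (\<integral>\<^sup>+x. norm (f x) \<partial>M)" by (rule has_bochner_int_norm_le[OF f])
  also have "\<dots> \<le> (\<integral>\<^sup>+x. h x \<partial>M)" by (intro nn_integral_mono ennreal_leI le)
  also have "\<dots> = ennreal (\<integral>x. h x \<partial>M)"
    using h h0 by (intro nn_integral_eq_integral) (auto simp: has_bochner_integral_iff)
  also have "(\<integral>x. h x \<partial>M) = c" using h by (rule has_bochner_integral_integral_eq)
  finally show ?thesis
  proof (rule ennreal_le_iff[THEN iffD1, rotated])
    show "0 \<le> c" using h h0 by (metis Bochner_Integration.integral_nonneg has_bochner_integral_integral_eq)
  qed
qed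

text \<open>If the integral exists, this is the usual estimate. Otherwise \<open>bochner_int\<close>
  takes its default value 0, and the bound holds because \<open>c\<close> is the integral of a
  nonnegative function.\<close>

lemma bochner_int_norm_bound:
  fixes f :: "'b \<Rightarrow> 'a::banach" and h :: "'b \<Rightarrow> real"
  assumes h: "has_bochner_integral M h c"
    and le: "\<And>x. x \<in> space M \<Longrightarrow> norm (f x) \<le> h x"
  shows "norm (bochner_int M f) \<le> c"
proof (cases "bochner_integrable M f")
  case True
  then show ?thesis using has_bochner_int_norm_bound[OF has_bochner_int_bochner_int h le] by blast
next
  case False
  have h0: "0 \<le> h x" if "x \<in> space M" for x
    by (rule order_trans[OF norm_ge_zero le[OF that]])
  have "0 \<le> c" using h h0 by (metis Bochner_Integration.integral_nonneg has_bochner_integral_integral_eq)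
  with False show ?thesis by (simp add: bochner_int_def)
qed

text \<open>The comparison principle behind both asymptotic estimates below: \<open>u\<close> is
  replaced by a scalar function times a fixed vector, whose integral is known, and a scalar function
  dominates the error.\<close>

lemma bochner_int_near_scaleR:
  fixes u :: "'b \<Rightarrow> 'a::banach"
  assumes "bochner_integrable M u" "has_bochner_integral M h c" "has_bochner_integral M k d"
    and "\<And>x. x \<in> space M \<Longrightarrow> norm (u x - h x *\<^sub>R z) \<le> k x"
  shows "norm (bochner_int M u - c *\<^sub>R z) \<le> d"
  by (rule has_bochner_int_norm_bound[OF has_bochner_int_diff[OF has_bochner_int_bochner_int
        has_bochner_int_scaleR_left]]) (use assms in auto)

lemma bochner_int_cong:
  assumes "\<And>x. x \<in> space M \<Longrightarrow> f x = g x"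
  shows "bochner_int M f = bochner_int M g" "bochner_integrable M f = bochner_integrable M g"
proof -
  have "has_bochner_int M f y = has_bochner_int M g y" for y
  proof -
    have "(\<integral>\<^sup>+x. norm (f x - s x) \<partial>M) = (\<integral>\<^sup>+x. norm (g x - s x) \<partial>M)" for s
      by (rule nn_integral_cong) (simp add: assms)
    then show ?thesis
      unfolding has_bochner_int_def using strongly_measurable_cong[of M f g, OF assms] by simp
  qed
  then have "has_bochner_int M f = has_bochner_int M g" by (rule ext)
  then show "bochner_int M f = bochner_int M g" "bochner_integrable M f = bochner_integrable M g"
    by (simp_all add: bochner_int_def bochner_integrable_def cong: if_cong)
qed

lemma has_bochner_int_zero: "has_bochner_int M (\<lambda>x. 0) 0"
  using has_bochner_int_scaleR_left[OF has_bochner_integral_zero, of M 0] by simp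

subsection \<open>A bump function and its moments\<close>

lemma continuous_on_Icc_norm_bounded:
  fixes f :: "real \<Rightarrow> 'a::real_normed_vector"
  assumes "continuous_on {a..b} f"
  obtains B where "\<And>x. x \<in> {a..b} \<Longrightarrow> norm (f x) \<le> B"
  using compact_imp_bounded[OF compact_continuous_image[OF assms compact_Icc]] that
  unfolding bounded_iff by blast

definition bump_weight :: "real poly" where "bump_weight = [:-2, 3, -1:]"

lemma poly_bump_weight: "poly bump_weight x = (x - 1) * (2 - x)"
  by (simp add: bump_weight_def algebra_simps)

text \<open>
  With \<open>w = (x - 1)(2 - x)\<close>, the functions \<open>p w\<^sup>-\<^sup>k exp(-1/w)\<close> on \<open>(1,2)\<close>, extended by \<open>0\<close>, are closed under
  differentiation; hence all of them are smooth.
\<close>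
definition bump :: "real poly \<Rightarrow> nat \<Rightarrow> real \<Rightarrow> real" where
  "bump p k x = (if x \<in> {1<..<2}
     then poly p x / poly bump_weight x ^ k * exp (- 1 / poly bump_weight x) else 0)"

lemma bump_eq_0: "x \<notin> {1<..<2} \<Longrightarrow> bump p k x = 0"
  by (auto simp: bump_def)

text \<open>The numerator over w^(k + 2) in the derivative of p w^(-k) exp(-1/w): the three summands
  come from differentiating p, w^(-k) and the exponential.\<close>

definition bump_deriv :: "real poly \<Rightarrow> nat \<Rightarrow> real poly" where
  "bump_deriv p k = pderiv p * bump_weight ^ 2 - smult (of_nat k) (p * pderiv bump_weight * bump_weight)
     + p * pderiv bump_weight"

text \<open>The exponential series of exp(1/w) has positive terms, so it dominates its term of index
  m; then take reciprocals.\<close>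

lemma exp_minus_inverse_le_power:
  fixes w :: real
  assumes "w > 0"
  shows "exp (- 1 / w) \<le> fact m * w ^ m"
proof -
  have "(\<Sum>n\<in>{m}. (1 / w) ^ n /\<^sub>R fact n) \<le> exp (1 / w)"
    unfolding exp_def using assms by (intro sum_le_suminf summable_exp_generic) auto
  then show ?thesis
    using assms by (simp add: exp_minus field_simps)
qed

text \<open>The exponential decay absorbs w^(-k) and leaves two further powers of w, whence the
  exponent k + 2 below. Quadratic vanishing gives derivative 0 at every point outside the open
  interval, in particular at 1 and 2.\<close>

lemma bump_quadratic_bound:
  assumes "x0 \<notin> {1<..<2}"
  shows "\<exists>K. \<forall>x. \<bar>bump p k x\<bar> \<le> K * (x - x0)\<^sup>2"
proof -
  have "continuous_on {1..2} (poly p)" by (intro continuous_intros)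
  then obtain B where "\<And>x. x \<in> {1..2} \<Longrightarrow> norm (poly p x) \<le> B"
    by (rule continuous_on_Icc_norm_bounded) (rule that)
  then have B: "\<And>x. x \<in> {1..2} \<Longrightarrow> \<bar>poly p x\<bar> \<le> B" by simp
  have "B \<ge> 0" using B[of 1] by simp
  have "\<bar>bump p k x\<bar> \<le> (B * fact (k + 2)) * (x - x0)\<^sup>2" for x
  proof (cases "x \<in> {1<..<2}")
    case True
    define w where "w = poly bump_weight x"
    \<comment> \<open>Both factors of w = (x - 1)(2 - x) lie in (0,1), so w is at most either of
      them. One of them is at most |x - x0|, since x0 lies at or beyond an end point.\<close>
    have w: "w > 0" "w \<le> x - 1" "w \<le> 2 - x"
      using True by (auto simp: w_def poly_bump_weight mult_le_cancel_left1 mult_le_cancel_right1)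
    then have "w \<le> \<bar>x - x0\<bar>" using assms True by auto
    then have w2: "w\<^sup>2 \<le> (x - x0)\<^sup>2" using w(1) by (simp add: abs_le_square_iff[symmetric])
    have "\<bar>bump p k x\<bar> = \<bar>poly p x\<bar> / w ^ k * exp (- 1 / w)"
      using True w(1) by (simp add: bump_def abs_mult flip: w_def)
    also have "\<dots> \<le> B / w ^ k * (fact (k + 2) * w ^ (k + 2))"
      using True w(1) B[of x] \<open>B \<ge> 0\<close>
      by (intro mult_mono divide_right_mono exp_minus_inverse_le_power) auto
    also have "\<dots> = B * fact (k + 2) * w\<^sup>2" using w(1) by (simp add: power_add power2_eq_square)
    also have "\<dots> \<le> B * fact (k + 2) * (x - x0)\<^sup>2"
      using w2 \<open>B \<ge> 0\<close> by (intro mult_left_mono) auto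
    finally show ?thesis .
  qed (use \<open>B \<ge> 0\<close> in \<open>simp add: bump_eq_0\<close>)
  then show ?thesis by blast
qed

lemma has_real_derivative_zero_if_quadratic_bound:
  fixes f :: "real \<Rightarrow> real"
  assumes "\<And>x. \<bar>f x\<bar> \<le> K * (x - x0)\<^sup>2"
  shows "(f has_real_derivative 0) (at x0)"
proof -
  have f0: "f x0 = 0" using assms[of x0] by simp
  have "((\<lambda>x. (f x - f x0) / (x - x0)) \<longlongrightarrow> 0) (at x0)"
  proof (rule Lim_null_comparison)
    show "\<forall>\<^sub>F x in at x0. norm ((f x - f x0) / (x - x0)) \<le> K * \<bar>x - x0\<bar>"
    proof (rule eventually_at_filter[THEN iffD2], intro always_eventually allI impI)
      fix x assume "x \<noteq> x0"
      then show "norm ((f x - f x0) / (x - x0)) \<le> K * \<bar>x - x0\<bar>"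
        using assms[of x] f0 by (simp add: pos_divide_le_eq power2_eq_square mult.assoc flip: abs_mult)
    qed
    have "((\<lambda>x. K * \<bar>x - x0\<bar>) \<longlongrightarrow> K * \<bar>x0 - x0\<bar>) (at x0)" by (intro tendsto_intros)
    then show "((\<lambda>x. K * \<bar>x - x0\<bar>) \<longlongrightarrow> 0) (at x0)" by simp
  qed
  then show ?thesis by (simp add: has_field_derivative_iff)
qed

lemma has_real_derivative_over_power_times_exp:
  fixes P w :: "real \<Rightarrow> real"
  assumes P: "(P has_real_derivative P') (at x)" and w: "(w has_real_derivative w') (at x)"
    and "w x > 0"
  shows "((\<lambda>x. P x / w x ^ k * exp (- 1 / w x)) has_real_derivative
    (P' * (w x)\<^sup>2 - real k * (P x * w' * w x) + P x * w') / w x ^ (k + 2) * exp (- 1 / w x)) (at x)"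
proof -
  have "((\<lambda>x. P x / w x ^ k * exp (- 1 / w x)) has_real_derivative
      (P' * w x ^ k - P x * (real k * (w x ^ (k - Suc 0) * w'))) / (w x ^ k * w x ^ k) * exp (- 1 / w x)
      + exp (- 1 / w x) * (w' / (w x * w x)) * (P x / w x ^ k)) (at x)"
    using assms(3) by (auto intro!: derivative_eq_intros P w simp: field_simps)
  also have "(P' * w x ^ k - P x * (real k * (w x ^ (k - Suc 0) * w'))) / (w x ^ k * w x ^ k) * exp (- 1 / w x)
      + exp (- 1 / w x) * (w' / (w x * w x)) * (P x / w x ^ k) =
      (P' * (w x)\<^sup>2 - real k * (P x * w' * w x) + P x * w') / w x ^ (k + 2) * exp (- 1 / w x)"
    using assms(3) by (cases k) (simp_all add: field_simps power2_eq_square)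
  finally show ?thesis .
qed

lemma bump_has_derivative: "(bump p k has_real_derivative bump (bump_deriv p k) (k + 2) x) (at x)"
proof (cases "x \<in> {1<..<2}")
  case False
  then show ?thesis
    using bump_quadratic_bound[OF False, of p k] has_real_derivative_zero_if_quadratic_bound[of "bump p k"]
    by (auto simp: bump_eq_0)
next
  case True
  have "poly bump_weight x > 0" using True by (simp add: poly_bump_weight)
  from has_real_derivative_over_power_times_exp[OF poly_DERIV[of p x] poly_DERIV[of bump_weight x] this, of k]
  have "((\<lambda>x. poly p x / poly bump_weight x ^ k * exp (- 1 / poly bump_weight x)) has_real_derivative
      bump (bump_deriv p k) (k + 2) x) (at x)"
    using True by (simp add: bump_def bump_deriv_def)
  then show ?thesis
    by (rule has_field_derivative_transform_within_open[of _ _ _ "{1<..<2}"]) (use True in \<open>auto simp: bump_def\<close>)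
qed

lemma continuous_on_bump: "continuous_on S (bump p k)"
  by (rule DERIV_continuous_on[OF has_field_derivative_at_within[OF bump_has_derivative]])

section \<open>Rescaled bumps: derivatives, moments, and use as test functions\<close>

lemma bump_affine_has_derivative:
  "((\<lambda>x. bump p k ((x - c) / e) / e ^ n) has_real_derivative
     bump (bump_deriv p k) (k + 2) ((x - c) / e) / e ^ Suc n) (at x)"
proof -
  have "((\<lambda>x. (x - c) / e) has_real_derivative 1 / e) (at x)"
    by (intro DERIV_cdivide) (auto intro!: derivative_eq_intros)
  from DERIV_cdivide[OF DERIV_chain2[OF bump_has_derivative this], of p k "e ^ n"]
  show ?thesis by simp
qed

text \<open>Integration by parts; the boundary terms vanish because the bump is 0 at 1 and 2. Since
  [1,2] stays away from 0, the power is differentiable there for every real \<beta>.\<close>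

lemma bump_times_powr_integral_deriv:
  "integral {1..2} (\<lambda>r. bump (bump_deriv p k) (k + 2) r * r powr \<beta>) =
     - \<beta> * integral {1..2} (\<lambda>r. bump p k r * r powr (\<beta> - 1))"
proof -
  have "((\<lambda>r. bump (bump_deriv p k) (k + 2) r * r powr \<beta> + \<beta> * (bump p k r * r powr (\<beta> - 1)))
     has_integral (bump p k 2 * 2 powr \<beta> - bump p k 1 * 1 powr \<beta>)) {1..2}"
  proof (rule fundamental_theorem_of_calculus)
    show "((\<lambda>r. bump p k r * r powr \<beta>) has_vector_derivative
        bump (bump_deriv p k) (k + 2) r * r powr \<beta> + \<beta> * (bump p k r * r powr (\<beta> - 1)))
        (at r within {1..2})" if "r \<in> {1..2}" for r
    proof -
      have "((\<lambda>r. bump p k r * r powr \<beta>) has_real_derivative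
        bump (bump_deriv p k) (k + 2) r * r powr \<beta> + \<beta> * (bump p k r * r powr (\<beta> - 1))) (at r)"
        using that by (auto intro!: derivative_eq_intros bump_has_derivative)
      then show ?thesis
        by (simp add: has_real_derivative_iff_has_vector_derivative has_vector_derivative_at_within)
    qed
  qed simp
  then have *: "integral {1..2} (\<lambda>r. bump (bump_deriv p k) (k + 2) r * r powr \<beta>
      + \<beta> * (bump p k r * r powr (\<beta> - 1))) = 0"
    by (simp add: bump_eq_0 integral_unique)
  have "(\<lambda>r. bump q m r * r powr \<gamma>) integrable_on {1..2}" for q m \<gamma>
    by (intro integrable_continuous_interval continuous_intros continuous_on_bump) auto
  then show ?thesis
    using * by (subst (asm) Henstock_Kurzweil_Integration.integral_add) (auto intro: integrable_on_mult_right)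
qed

text \<open>The pair \<open>q\<close>, \<open>m\<close> depends on \<open>n\<close> alone, so its
  moments stay fixed when the scale \<open>e\<close> shrinks. Each integration by parts multiplies
  the moment by -\<beta> and lowers \<beta> by 1; a nonintegral exponent stays nonintegral and never
  makes this factor vanish.\<close>

lemma bump_higher_deriv:
  "\<exists>q m. (\<forall>c e. e > 0 \<longrightarrow>
       (deriv ^^ n) (\<lambda>x. bump 1 0 ((x - c) / e)) = (\<lambda>x. bump q m ((x - c) / e) / e ^ n)) \<and>
     (\<forall>\<beta>. \<beta> \<notin> \<int> \<longrightarrow> integral {1..2} (\<lambda>r. bump q m r * r powr \<beta>) \<noteq> 0)"
proof (induction n)
  case 0
  \<comment> \<open>The undifferentiated integrand is continuous and nonnegative, so a zero integral
    would make it vanish everywhere on [1,2]; it is positive at 3/2.\<close>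
  have "integral {1..2} (\<lambda>r. bump 1 0 r * r powr \<beta>) \<noteq> 0" for \<beta>
  proof
    assume "integral {1..2} (\<lambda>r. bump 1 0 r * r powr \<beta>) = 0"
    moreover have "integral {1..2} (\<lambda>r. bump 1 0 r * r powr \<beta>) = 0 \<longleftrightarrow>
        (\<forall>r\<in>{1..2}. bump 1 0 r * r powr \<beta> = 0)"
      by (intro integral_eq_0_iff continuous_intros continuous_on_bump) (auto simp: bump_def)
    ultimately have "bump 1 0 (3/2) * (3/2) powr \<beta> = 0" by simp
    then show False by (simp add: bump_def)
  qed
  then show ?case by (intro exI[of _ 1] exI[of _ 0]) simp
next
  case (Suc n)
  then obtain q m where q: "\<And>c e. e > 0 \<Longrightarrow>
       (deriv ^^ n) (\<lambda>x. bump 1 0 ((x - c) / e)) = (\<lambda>x. bump q m ((x - c) / e) / e ^ n)"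
     "\<And>\<beta>. \<beta> \<notin> \<int> \<Longrightarrow> integral {1..2} (\<lambda>r. bump q m r * r powr \<beta>) \<noteq> 0"
    by blast
  show ?case
  proof (intro exI[of _ "bump_deriv q m"] exI[of _ "m + 2"] conjI allI impI)
    show "(deriv ^^ Suc n) (\<lambda>x. bump 1 0 ((x - c) / e)) =
        (\<lambda>x. bump (bump_deriv q m) (m + 2) ((x - c) / e) / e ^ Suc n)" if "e > 0" for c e
      unfolding funpow.simps comp_apply q(1)[OF that]
      by (intro ext DERIV_imp_deriv bump_affine_has_derivative)
    show "integral {1..2} (\<lambda>r. bump (bump_deriv q m) (m + 2) r * r powr \<beta>) \<noteq> 0" if "\<beta> \<notin> \<int>" for \<beta>
    proof -
      have "\<beta> - 1 \<notin> \<int>" using that Ints_add[of "\<beta> - 1" 1] by auto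
      moreover have "\<beta> \<noteq> 0" using that by auto
      ultimately show ?thesis using q(2) by (simp add: bump_times_powr_integral_deriv del: add_2_eq_Suc')
    qed
  qed
qed

lemma test_function_bump:
  assumes "e > 0" "a + 2 * e < b"
  shows "test_function a b (\<lambda>x. bump 1 0 ((x - a) / e))"
proof -
  have "(deriv ^^ n) (\<lambda>x. bump 1 0 ((x - a) / e)) field_differentiable at x" for n x
  proof -
    obtain q m where "(deriv ^^ n) (\<lambda>x. bump 1 0 ((x - a) / e)) = (\<lambda>x. bump q m ((x - a) / e) / e ^ n)"
      using bump_higher_deriv[of n] assms by blast
    then show ?thesis
      using bump_affine_has_derivative[of q m a e n x] unfolding field_differentiable_def by auto
  qed
  moreover have "bump 1 0 ((x - a) / e) = 0" if "x \<notin> {a + e..a + 2 * e}" for x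
    using that assms by (intro bump_eq_0) (auto simp: field_simps)
  moreover have "a < a + e" using assms by simp
  ultimately show ?thesis unfolding test_function_def using assms(2) by blast
qed

text \<open>Substitution r = (t - a)/e. The change of variables is done for the Henstock-Kurzweil
  integral over the support [a + e, a + 2e]; absolute integrability turns it into a Lebesgue
  integral, and vanishing off the support extends it to [a, b].\<close>

lemma has_bochner_integral_rescaled:
  fixes \<psi> :: "real \<Rightarrow> real"
  assumes cont: "continuous_on {1..2} \<psi>" and supp: "\<And>r. r \<notin> {1..2} \<Longrightarrow> \<psi> r = 0"
    and e: "e > 0" "a + 2 * e \<le> b"
  shows "has_bochner_integral (lebesgue_on {a..b}) (\<lambda>t. \<psi> ((t - a) / e)) (e * integral {1..2} \<psi>)"
proof -
  have hi: "((\<lambda>t. \<psi> ((t - a) / e)) has_integral (e * integral {1..2} \<psi>)) {a + e..a + 2 * e}"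
  proof -
    have "(\<psi> has_integral integral {1..2} \<psi>) (cbox 1 2)"
      using cont by (simp add: integrable_continuous_interval integrable_integral)
    from has_integral_affinity'[OF this, of "1 / e" "- a / e"]
    have "((\<lambda>t. \<psi> (1 / e * t + - a / e)) has_integral integral {1..2} \<psi> / (1 / e))
        {(1 - - a / e) / (1 / e)..(2 - - a / e) / (1 / e)}"
      using e by (simp add: divide_inverse_commute del: minus_divide_left)
    moreover have "1 / e * t + - a / e = (t - a) / e" for t by (simp add: diff_divide_distrib)
    moreover have "(1 - - a / e) / (1 / e) = a + e" "(2 - - a / e) / (1 / e) = a + 2 * e"
      using e by (simp_all add: field_simps)
    ultimately show ?thesis by (simp add: mult.commute)
  qed
  have ai: "(\<lambda>t. \<psi> ((t - a) / e)) absolutely_integrable_on {a + e..a + 2 * e}"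
    using e by (intro absolutely_integrable_continuous_real continuous_on_compose2[OF cont] continuous_intros)
      (auto simp: field_simps)
  have ind: "indicator {a..b} t *\<^sub>R \<psi> ((t - a) / e) = indicator {a + e..a + 2 * e} t *\<^sub>R \<psi> ((t - a) / e)" for t
    using e supp[of "(t - a) / e"] by (auto simp: indicator_def field_simps)
  have "has_bochner_integral (lebesgue_on {a + e..a + 2 * e}) (\<lambda>t. \<psi> ((t - a) / e)) (e * integral {1..2} \<psi>)"
    using ai hi absolutely_integrable_imp_integrable[OF ai]
    by (simp add: has_bochner_integral_iff lebesgue_integral_eq_integral integral_unique)
  then show ?thesis
    by (subst has_bochner_integral_restrict_space, simp, subst ind)
      (simp add: has_bochner_integral_restrict_space)
qed

subsection \<open>Behaviour of the Riemann--Liouville integral at the left end point\<close>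

text \<open>The Beta integral transported from [0,1] to [a,t]. The integrand is nonnegative, so its
  gauge integrability already yields Lebesgue integrability despite the singularity at s = t when
  \<gamma> < 1.\<close>

lemma has_bochner_integral_RL_kernel_power:
  fixes a t \<gamma> :: real
  assumes "a < t" "\<gamma> > 0"
  shows "has_bochner_integral (lebesgue_on {a..t}) (\<lambda>s. (t - s) powr (\<gamma> - 1) * (s - a) ^ j)
           (Beta (real j + 1) \<gamma> * (t - a) powr (real j + \<gamma>))"
proof -
  define L where "L = t - a"
  have L: "L > 0" using assms by (simp add: L_def)
  have "((\<lambda>x. x powr real j * (1 - x) powr (\<gamma> - 1)) has_integral Beta (real j + 1) \<gamma>) (cbox 0 1)"
    using has_integral_Beta_real[of "real j + 1" \<gamma>] assms by simp
  from has_integral_affinity'[OF this, of "1 / L" "- a / L"]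
  have "((\<lambda>s. (1 / L * s + - a / L) powr real j * (1 - (1 / L * s + - a / L)) powr (\<gamma> - 1)) has_integral
      Beta (real j + 1) \<gamma> / (1 / L)) {(0 - - a / L) / (1 / L)..(1 - - a / L) / (1 / L)}"
    using L by (simp add: divide_inverse_commute del: minus_divide_left)
  moreover have "(0 - - a / L) / (1 / L) = a" "(1 - - a / L) / (1 / L) = t"
    using L by (simp_all add: field_simps L_def)
  moreover have "1 / L * s + - a / L = (s - a) / L" for s
    by (simp add: diff_divide_distrib)
  moreover have "1 - (s - a) / L = (t - s) / L" for s
    using L by (simp add: L_def divide_simps)
  ultimately have "((\<lambda>s. ((s - a) / L) powr real j * ((t - s) / L) powr (\<gamma> - 1)) has_integral
      Beta (real j + 1) \<gamma> * L) {a..t}"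
    by simp
  \<comment> \<open>This factor removes the normalisation by \<open>L\<close> in the integrand.
    Together with the factor \<open>L\<close> from the substitution it gives the power of exponent j
    + \<gamma>.\<close>
  from has_integral_mult_right[OF this, of "L powr real j * L powr (\<gamma> - 1)"]
  have "((\<lambda>s. L powr real j * L powr (\<gamma> - 1) * (((s - a) / L) powr real j * ((t - s) / L) powr (\<gamma> - 1)))
      has_integral L powr real j * L powr (\<gamma> - 1) * (Beta (real j + 1) \<gamma> * L)) {a..t}" .
  moreover have "L powr real j * L powr (\<gamma> - 1) * (Beta (real j + 1) \<gamma> * L)
      = Beta (real j + 1) \<gamma> * L powr (real j + \<gamma>)"
    using L by (simp add: powr_add powr_diff)
  ultimately have "((\<lambda>s. L powr real j * L powr (\<gamma> - 1) * (((s - a) / L) powr real j * ((t - s) / L) powr (\<gamma> - 1)))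
      has_integral Beta (real j + 1) \<gamma> * L powr (real j + \<gamma>)) {a..t}"
    by simp
  then have hi: "((\<lambda>s. (t - s) powr (\<gamma> - 1) * (s - a) ^ j) has_integral
      Beta (real j + 1) \<gamma> * L powr (real j + \<gamma>)) {a..t}"
  \<comment> \<open>The point \<open>a\<close> is excepted because \<open>0 powr 0 = 0\<close>
    whereas \<open>0 ^ 0 = 1\<close>, so the integrands differ there for j = 0.\<close>
  proof (rule has_integral_spike_finite[of "{a}", rotated 2])
    show "(t - s) powr (\<gamma> - 1) * (s - a) ^ j
        = L powr real j * L powr (\<gamma> - 1) * (((s - a) / L) powr real j * ((t - s) / L) powr (\<gamma> - 1))"
      if "s \<in> {a..t} - {a}" for s
      using that L by (simp add: powr_divide powr_realpow)
  qed simp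
  have ai: "(\<lambda>s. (t - s) powr (\<gamma> - 1) * (s - a) ^ j) absolutely_integrable_on {a..t}"
    by (rule nonnegative_absolutely_integrable_1) (use hi in auto)
  show ?thesis
    using hi absolutely_integrable_imp_integrable[OF ai]
    by (simp add: has_bochner_integral_iff lebesgue_integral_eq_integral integral_unique L_def)
qed

section \<open>Taylor expansion at the left end point and its image under the fractional
  integral\<close>

lemma norm_le_if_vector_derivative_bounded:
  fixes h :: "real \<Rightarrow> 'a::real_normed_vector"
  assumes der: "\<And>s. s \<in> {a..t} \<Longrightarrow> (h has_vector_derivative h' s) (at s within {a..t})"
    and bound: "\<And>s. s \<in> {a..t} \<Longrightarrow> norm (h' s) \<le> B" and "h a = 0" "a \<le> t"
  shows "norm (h t) \<le> B * (t - a)"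
proof -
  have "norm (h t - h a) \<le> B * norm (t - a)"
  proof (rule differentiable_bound[of "{a..t}"])
    show "onorm (\<lambda>x. x *\<^sub>R h' s) \<le> B" if "s \<in> {a..t}" for s
      using mult_left_mono[OF bound[OF that] abs_ge_zero] by (intro onorm_le) (simp add: mult.commute)
  qed (use der \<open>a \<le> t\<close> in \<open>auto simp: has_vector_derivative_def\<close>)
  then show ?thesis using \<open>h a = 0\<close> \<open>a \<le> t\<close> by simp
qed

text \<open>A Peano-type expansion: continuity of the derivative \<open>D j\<close> at
  \<open>a\<close> gives the estimate for order 0, and the mean value inequality lifts it through
  one integration at a time down to \<open>D 0\<close>.\<close>

lemma Taylor_first_nonzero_term:
  fixes D :: "nat \<Rightarrow> real \<Rightarrow> 'a::real_normed_vector"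
  assumes der: "\<And>i t. i < j \<Longrightarrow> t \<in> {a..b} \<Longrightarrow> (D i has_vector_derivative D (Suc i) t) (at t within {a..b})"
    and cont: "continuous_on {a..b} (D j)" and zero: "\<And>i. i < j \<Longrightarrow> D i a = 0"
    and "a < b" "\<eta> > 0"
  shows "\<exists>\<delta>>0. \<forall>t. a \<le> t \<and> t \<le> a + \<delta> \<longrightarrow>
           norm (D 0 t - (t - a) ^ j *\<^sub>R (D j a /\<^sub>R fact j)) \<le> \<eta> * (t - a) ^ j"
proof -
  have "a \<in> {a..b}" using \<open>a < b\<close> by simp
  then have "\<exists>d>0. \<forall>t\<in>{a..b}. dist t a < d \<longrightarrow> dist (D j t) (D j a) < \<eta>"
    using cont \<open>\<eta> > 0\<close> unfolding continuous_on_iff by blast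
  then obtain d where d: "d > 0" "\<forall>t\<in>{a..b}. dist t a < d \<longrightarrow> dist (D j t) (D j a) < \<eta>"
    by blast
  define \<delta> where "\<delta> = min (d / 2) (b - a)"
  have \<delta>: "\<delta> > 0" "a + \<delta> \<le> b" "\<delta> < d" using d(1) \<open>a < b\<close> by (simp_all add: \<delta>_def)
  \<comment> \<open>\<open>R i\<close> is the error in replacing \<open>D (j - i)\<close> by its
    leading term. The indexing is reversed so that \<open>R (Suc i)\<close> has derivative
    \<open>R i\<close> and vanishes at \<open>a\<close>, as induction on \<open>i\<close>
    requires.\<close>
  define R where "R i t = D (j - i) t - ((t - a) ^ i / fact i) *\<^sub>R D j a" for i t
  have R_deriv: "(R (Suc i) has_vector_derivative R i s) (at s within {a..b})"
    if "Suc i \<le> j" "s \<in> {a..b}" for i s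
  proof -
    have "((\<lambda>t. t - a) has_real_derivative 1) (at s within {a..b})"
      by (auto intro!: derivative_eq_intros)
    from DERIV_cdivide[OF DERIV_power_Suc[OF this, of i], of "fact (Suc i)"]
    have "((\<lambda>t. (t - a) ^ Suc i / fact (Suc i)) has_real_derivative
        ((1 + real i) * (s - a) ^ i) / ((1 + real i) * fact i)) (at s within {a..b})"
      by (simp only: mult_1_left fact_Suc of_nat_Suc)
    moreover have "((1 + real i) * (s - a) ^ i) / ((1 + real i) * fact i) = (s - a) ^ i / fact i"
      by (rule mult_divide_mult_cancel_left) simp
    ultimately have "((\<lambda>t. (t - a) ^ Suc i / fact (Suc i)) has_real_derivative (s - a) ^ i / fact i)
        (at s within {a..b})"
      by (simp only:)
    from has_vector_derivative_scaleR[OF this has_vector_derivative_const[of "D j a"]]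
    have "((\<lambda>t. ((t - a) ^ Suc i / fact (Suc i)) *\<^sub>R D j a) has_vector_derivative
        ((s - a) ^ i / fact i) *\<^sub>R D j a) (at s within {a..b})"
      by (simp only: scaleR_zero_right add_0_left)
    moreover have "(D (j - Suc i) has_vector_derivative D (j - i) s) (at s within {a..b})"
      using der[of "j - Suc i" s] that by (simp add: Suc_diff_Suc)
    ultimately show ?thesis
      unfolding R_def by (intro has_vector_derivative_diff)
  qed
  have R_a: "R (Suc i) a = 0" if "Suc i \<le> j" for i
    using zero[of "j - Suc i"] that by (simp add: R_def)
  have "norm (R i t) \<le> \<eta> * (t - a) ^ i" if "i \<le> j" "a \<le> t" "t \<le> a + \<delta>" for i t
    using that
  proof (induction i arbitrary: t)
    case 0
    then have "dist (D j t) (D j a) < \<eta>"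
      using \<delta> by (intro d(2)[rule_format]) (auto simp: dist_real_def)
    then show ?case by (simp add: dist_norm R_def)
  next
    case (Suc i)
    have "norm (R (Suc i) t) \<le> (\<eta> * (t - a) ^ i) * (t - a)"
    proof (rule norm_le_if_vector_derivative_bounded[where h = "R (Suc i)" and h' = "R i"])
      fix s assume s: "s \<in> {a..t}"
      show "(R (Suc i) has_vector_derivative R i s) (at s within {a..t})"
        by (rule has_vector_derivative_within_subset[OF R_deriv]) (use s Suc.prems \<delta> in auto)
      have "norm (R i s) \<le> \<eta> * (s - a) ^ i"
        using Suc.IH[of s] Suc.prems s by simp
      moreover have "(s - a) ^ i \<le> (t - a) ^ i"
        by (rule power_mono) (use s in auto)
      then have "\<eta> * (s - a) ^ i \<le> \<eta> * (t - a) ^ i"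
        using \<open>\<eta> > 0\<close> by simp
      ultimately show "norm (R i s) \<le> \<eta> * (t - a) ^ i"
        by (rule order_trans)
    next
      show "R (Suc i) a = 0" using R_a Suc.prems by simp
      show "a \<le> t" using Suc.prems by simp
    qed
    then show ?case by (simp add: mult_ac)
  qed
  from this[of j] have "norm (D 0 t - ((t - a) ^ j / fact j) *\<^sub>R D j a) \<le> \<eta> * (t - a) ^ j"
    if "a \<le> t" "t \<le> a + \<delta>" for t
    using that by (simp add: R_def)
  moreover have "((t - a) ^ j / fact j) *\<^sub>R D j a = (t - a) ^ j *\<^sub>R (D j a /\<^sub>R fact j)" for t
    by (simp add: divide_inverse)
  ultimately show ?thesis using \<delta>(1) by (intro exI[of _ \<delta>]) simp
qed

text \<open>The fractional integral maps (s - a)^j to a multiple of (t - a)^(j + \<gamma>). Because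
  its kernel is nonnegative, a relative error \<eta> in the integrand survives with the same
  \<eta>.\<close>

lemma RL_integral_near_power:
  fixes f :: "real \<Rightarrow> 'a::banach"
  assumes cont: "continuous_on {a..b} f" and t: "a < t" "t \<le> b" and "\<gamma> > 0"
    and near: "\<And>s. s \<in> {a..t} \<Longrightarrow> norm (f s - (s - a) ^ j *\<^sub>R z) \<le> \<eta> * (s - a) ^ j"
  shows "norm (RL_integral a \<gamma> f t - (Beta (real j + 1) \<gamma> / Gamma \<gamma> * (t - a) powr (real j + \<gamma>)) *\<^sub>R z)
     \<le> \<eta> * (Beta (real j + 1) \<gamma> / Gamma \<gamma>) * (t - a) powr (real j + \<gamma>)"
proof -
  let ?M = "lebesgue_on {a..t}"
  let ?I = "bochner_int ?M (\<lambda>s. (t - s) powr (\<gamma> - 1) *\<^sub>R f s)"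
  let ?c = "Beta (real j + 1) \<gamma> * (t - a) powr (real j + \<gamma>)"
  have contt: "continuous_on {a..t} f" using cont by (rule continuous_on_subset) (use t in auto)
  obtain B where B: "\<And>s. s \<in> {a..t} \<Longrightarrow> norm (f s) \<le> B"
    using contt by (rule continuous_on_Icc_norm_bounded) (rule that)
  have k: "has_bochner_integral ?M (\<lambda>s. (t - s) powr (\<gamma> - 1) * (s - a) ^ i)
           (Beta (real i + 1) \<gamma> * (t - a) powr (real i + \<gamma>))" for i
    by (rule has_bochner_integral_RL_kernel_power[OF t(1) \<open>\<gamma> > 0\<close>])
  have k0: "integrable ?M (\<lambda>s. (t - s) powr (\<gamma> - 1))"
    using k[of 0] by (simp add: has_bochner_integral_iff)
  have "bochner_integrable ?M (\<lambda>s. (t - s) powr (\<gamma> - 1) *\<^sub>R f s)"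
  proof (rule bochner_integrable_bound)
    show "strongly_measurable ?M (\<lambda>s. (t - s) powr (\<gamma> - 1) *\<^sub>R f s)"
      by (intro strongly_measurable_scaleR strongly_measurable_continuous_on contt
          borel_measurable_imp_strongly_measurable borel_measurable_integrable k0)
    show "integrable ?M (\<lambda>s. (t - s) powr (\<gamma> - 1) * B)"
      using k0 by simp
    show "norm ((t - s) powr (\<gamma> - 1) *\<^sub>R f s) \<le> (t - s) powr (\<gamma> - 1) * B" if "s \<in> space ?M" for s
      using that B by (auto intro!: mult_left_mono)
  qed
  then have *: "norm (?I - ?c *\<^sub>R z) \<le> \<eta> * ?c"
  proof (rule bochner_int_near_scaleR[OF _ k[of j] has_bochner_integral_mult_right[OF k[of j]]])
    fix s assume "s \<in> space ?M"
    then have "(t - s) powr (\<gamma> - 1) * norm (f s - (s - a) ^ j *\<^sub>R z) \<le> (t - s) powr (\<gamma> - 1) * (\<eta> * (s - a) ^ j)"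
      by (intro mult_left_mono near) auto
    moreover have "(t - s) powr (\<gamma> - 1) *\<^sub>R f s - ((t - s) powr (\<gamma> - 1) * (s - a) ^ j) *\<^sub>R z
        = (t - s) powr (\<gamma> - 1) *\<^sub>R (f s - (s - a) ^ j *\<^sub>R z)"
      by (simp add: scaleR_diff_right)
    ultimately show "norm ((t - s) powr (\<gamma> - 1) *\<^sub>R f s - ((t - s) powr (\<gamma> - 1) * (s - a) ^ j) *\<^sub>R z)
        \<le> \<eta> * ((t - s) powr (\<gamma> - 1) * (s - a) ^ j)"
      by (simp add: mult_ac)
  qed
  have G: "Gamma \<gamma> > 0" using \<open>\<gamma> > 0\<close> by (simp add: Gamma_real_pos)
  have "RL_integral a \<gamma> f t - (Beta (real j + 1) \<gamma> / Gamma \<gamma> * (t - a) powr (real j + \<gamma>)) *\<^sub>R z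
      = (1 / Gamma \<gamma>) *\<^sub>R (?I - ?c *\<^sub>R z)"
    using \<open>\<gamma> > 0\<close> by (simp add: RL_integral_def scaleR_diff_right)
  then have "norm (RL_integral a \<gamma> f t - (Beta (real j + 1) \<gamma> / Gamma \<gamma> * (t - a) powr (real j + \<gamma>)) *\<^sub>R z)
      = (1 / Gamma \<gamma>) * norm (?I - ?c *\<^sub>R z)"
    using G by simp
  also have "\<dots> \<le> (1 / Gamma \<gamma>) * (\<eta> * ?c)"
    by (rule mult_left_mono[OF *]) (use G in simp)
  finally show ?thesis by (simp add: mult_ac)
qed

section \<open>Testing the weak derivative with bumps shrinking towards the left end point\<close>

lemma le_if_le_plus_powr:
  fixes x y V \<theta> :: real
  assumes "\<theta> > 0" "e0 > 0" "\<And>e. 0 < e \<Longrightarrow> e < e0 \<Longrightarrow> x \<le> V * e powr \<theta> + y"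
  shows "x \<le> y"
proof (rule tendsto_lowerbound)
  have "((\<lambda>e. V * e powr \<theta> + y) \<longlongrightarrow> V * 0 powr \<theta> + y) (at_right 0)"
    using assms(1) by (intro tendsto_intros) (auto simp: eventually_at_filter)
  then show "((\<lambda>e. V * e powr \<theta> + y) \<longlongrightarrow> y) (at_right 0)" by simp
  show "\<forall>\<^sub>F e in at_right 0. x \<le> V * e powr \<theta> + y"
    unfolding eventually_at_right_field using assms(2,3) by (intro exI[of _ e0]) auto
qed simp

text \<open>Intended for \<open>z\<close> equal to the j-th Taylor coefficient of \<open>f\<close>
  at \<open>a\<close> once all lower ones are known to vanish.\<close>

lemma RL_deriv_leading_coeff_zero:
  fixes f v :: "real \<Rightarrow> 'a::banach"
  assumes "a < b" and \<gamma>: "0 < \<gamma>" "\<gamma> < 1" and "j < n"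
    and contf: "continuous_on {a..b} f" and contv: "continuous_on {a..b} v"
    and near: "\<And>\<eta>. \<eta> > 0 \<Longrightarrow> \<exists>\<delta>>0. \<forall>t. a \<le> t \<and> t \<le> a + \<delta> \<longrightarrow>
           norm (f t - (t - a) ^ j *\<^sub>R z) \<le> \<eta> * (t - a) ^ j"
    and weak: "has_weak_deriv a b n (RL_integral a \<gamma> f) v"
  shows "z = 0"
proof -
  let ?M = "lebesgue_on {a..b}"
  define \<beta> where "\<beta> = real j + \<gamma>"
  define g where "g = RL_integral a \<gamma> f"
  define C where "C = Beta (real j + 1) \<gamma> / Gamma \<gamma>"
  have "C > 0"
    using \<gamma> unfolding C_def Beta_def by (intro divide_pos_pos mult_pos_pos Gamma_real_pos) auto
  have "\<beta> \<notin> \<int>"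
  proof
    assume "\<beta> \<in> \<int>"
    then have "\<gamma> \<in> \<int>" using Ints_diff[of \<beta> "real j"] by (simp add: \<beta>_def)
    then show False using \<gamma> by (auto elim!: Ints_cases)
  qed
  from bump_higher_deriv[of n] obtain q m where qm: "\<forall>c e. e > 0 \<longrightarrow>
      (deriv ^^ n) (\<lambda>x. bump 1 0 ((x - c) / e)) = (\<lambda>x. bump q m ((x - c) / e) / e ^ n)"
      "\<forall>\<beta>. \<beta> \<notin> \<int> \<longrightarrow> integral {1..2} (\<lambda>r. bump q m r * r powr \<beta>) \<noteq> 0"
    by (elim exE conjE)
  define \<psi> where "\<psi> r = bump q m r * r powr \<beta>" for r
  \<comment> \<open>\<open>I\<close> is the decisive nonzero moment, \<open>K\<close> its absolute
    version weighing the Taylor error, and \<open>P\<close> the mass of the bump weighing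
    \<open>v\<close>. None of them depends on the scale \<open>e\<close>.\<close>
  define I K P where "I = integral {1..2} \<psi>" and "K = integral {1..2} (\<lambda>r. \<bar>\<psi> r\<bar>)"
    and "P = integral {1..2} (\<lambda>r. \<bar>bump 1 0 r\<bar>)"
  have "I \<noteq> 0" using qm(2) \<open>\<beta> \<notin> \<int>\<close> by (simp add: I_def \<psi>_def[abs_def])
  have cont_\<psi>: "continuous_on {1..2} \<psi>"
    unfolding \<psi>_def[abs_def] by (intro continuous_intros continuous_on_bump) auto
  have supp: "\<psi> r = 0" if "r \<notin> {1..2}" for r
    using that bump_eq_0[of r q m] by (auto simp: \<psi>_def)
  obtain V where V: "\<And>t. t \<in> {a..b} \<Longrightarrow> norm (v t) \<le> V"
    using contv by (rule continuous_on_Icc_norm_bounded) (rule that)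
  have loc: "loc_integrable a b g" using weak by (simp add: has_weak_deriv_def g_def)
  \<comment> \<open>The tested identity after division by e^(1 - n + \<beta>): the left side is the
    leading term, and the two summands on the right come from \<open>v\<close> and from the Taylor
    error.\<close>
  have main: "C * \<bar>I\<bar> * norm z \<le> V * P * e powr (real n - \<beta>) + \<eta> * C * K"
    if "\<eta> > 0" "e > 0" "a + 2 * e \<le> a + \<delta>" "a + 2 * e < b"
      and nr: "\<And>t. a \<le> t \<Longrightarrow> t \<le> a + \<delta> \<Longrightarrow> norm (f t - (t - a) ^ j *\<^sub>R z) \<le> \<eta> * (t - a) ^ j"
    for \<eta> e \<delta>
  proof -
    note e = that(2,4)
    define \<phi> where "\<phi> t = bump 1 0 ((t - a) / e)" for t
    define u where "u t = (bump q m ((t - a) / e) / e ^ n) *\<^sub>R g t" for t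
    \<comment> \<open>With t = a + e r, the leading part of \<open>u t\<close> is (C (t - a)^\<beta>
      / e^n) times the bump derivative at r. Collecting the powers of \<open>e\<close> leaves
      \<open>A * \<psi> r\<close>.\<close>
    define A where "A = C * e powr \<beta> / e ^ n"
    have "A > 0" using \<open>C > 0\<close> e by (simp add: A_def)
    have h: "has_bochner_integral ?M (\<lambda>t. A * \<psi> ((t - a) / e)) (A * (e * I))"
      unfolding I_def using e cont_\<psi> supp
      by (intro has_bochner_integral_mult_right has_bochner_integral_rescaled) auto
    have k: "has_bochner_integral ?M (\<lambda>t. \<eta> * A * \<bar>\<psi> ((t - a) / e)\<bar>) (\<eta> * A * (e * K))"
      unfolding K_def using e cont_\<psi> supp
      by (intro has_bochner_integral_mult_right has_bochner_integral_rescaled continuous_intros) auto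
    have u_near: "norm (u t - (A * \<psi> ((t - a) / e)) *\<^sub>R z) \<le> \<eta> * A * \<bar>\<psi> ((t - a) / e)\<bar>" for t
    proof (cases "(t - a) / e \<in> {1<..<2}")
      case True
      define r where "r = (t - a) / e"
      have r: "r > 1" "r < 2" "t = a + e * r" using True e by (auto simp: r_def)
      have t: "a < t" "t \<le> b" "t \<le> a + \<delta>"
      proof -
        have "e * r < e * 2" "0 < e * r" using r e by (auto intro!: mult_strict_left_mono mult_pos_pos simp del: mult_less_cancel_left_pos mult_less_cancel_left)
        then show "a < t" "t \<le> b" "t \<le> a + \<delta>" using r(3) e that(3) by linarith+
      qed
      have near: "norm (g t - (C * (t - a) powr \<beta>) *\<^sub>R z) \<le> \<eta> * C * (t - a) powr \<beta>"
        unfolding g_def C_def \<beta>_def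
        by (rule RL_integral_near_power[OF contf t(1,2) \<gamma>(1)]) (use nr t in auto)
      have pw: "(t - a) powr \<beta> = e powr \<beta> * r powr \<beta>" using r e by (simp add: powr_mult)
      have "u t - (A * \<psi> r) *\<^sub>R z = (bump q m r / e ^ n) *\<^sub>R (g t - (C * (t - a) powr \<beta>) *\<^sub>R z)"
        by (simp add: u_def pw A_def \<psi>_def scaleR_diff_right mult_ac flip: r_def)
      then have "norm (u t - (A * \<psi> r) *\<^sub>R z) = (\<bar>bump q m r\<bar> / e ^ n) * norm (g t - (C * (t - a) powr \<beta>) *\<^sub>R z)"
        using e by simp
      also have "\<dots> \<le> (\<bar>bump q m r\<bar> / e ^ n) * (\<eta> * C * (t - a) powr \<beta>)"
        using near e by (intro mult_left_mono) auto
      also have "\<dots> = \<eta> * A * \<bar>\<psi> r\<bar>"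
        by (simp add: pw A_def \<psi>_def abs_mult mult_ac)
      finally show ?thesis by (simp add: r_def)
    next
      case False
      then show ?thesis by (simp add: u_def \<psi>_def bump_eq_0)
    qed
    have u_int: "bochner_integrable ?M u"
    proof (rule bochner_integrable_bound)
      \<comment> \<open>Local integrability controls \<open>g\<close> only on compact subintervals
        of (a, b). The support of the rescaled bump is one of these, and \<open>u\<close> vanishes
        off it.\<close>
      have "strongly_measurable (lebesgue_on {a + e..a + 2 * e}) g"
        using loc e unfolding loc_integrable_def bochner_integrable_def has_bochner_int_def by auto
      moreover have "continuous_on {a + e..a + 2 * e} (\<lambda>t. bump q m ((t - a) / e) / e ^ n)"
        using e by (auto intro!: continuous_intros continuous_on_compose2[OF continuous_on_bump[of UNIV]])
      ultimately have "strongly_measurable (lebesgue_on {a + e..a + 2 * e}) u"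
        unfolding u_def by (intro strongly_measurable_scaleR[OF strongly_measurable_continuous_on])
      then have "strongly_measurable ?M (\<lambda>t. indicator {a + e..a + 2 * e} t *\<^sub>R u t)"
        by (rule strongly_measurable_extend) (use e in auto)
      moreover have "indicator {a + e..a + 2 * e} t *\<^sub>R u t = u t" for t
      proof (cases "(t - a) / e \<in> {1<..<2}")
        case True
        then show ?thesis using e by (auto simp: indicator_def field_simps)
      qed (simp add: u_def bump_eq_0)
      ultimately show "strongly_measurable ?M u" by simp
      show "integrable ?M (\<lambda>t. \<eta> * A * \<bar>\<psi> ((t - a) / e)\<bar> + norm (A * \<psi> ((t - a) / e)) * norm z)"
        using h k by (intro Bochner_Integration.integrable_add integrable_mult_left integrable_norm)
          (simp_all only: has_bochner_integral_iff)
      show "norm (u t) \<le> \<eta> * A * \<bar>\<psi> ((t - a) / e)\<bar> + norm (A * \<psi> ((t - a) / e)) * norm z" for t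
        using u_near[of t] norm_triangle_sub[of "u t" "(A * \<psi> ((t - a) / e)) *\<^sub>R z"]
        unfolding norm_scaleR by (simp add: abs_mult)
    qed
    have L: "norm (bochner_int ?M u - (A * (e * I)) *\<^sub>R z) \<le> \<eta> * A * (e * K)"
      by (rule bochner_int_near_scaleR[OF u_int h k u_near])
    have "bochner_int ?M u = (-1) ^ n *\<^sub>R bochner_int ?M (\<lambda>t. \<phi> t *\<^sub>R v t)"
    proof -
      have "test_function a b \<phi>" unfolding \<phi>_def by (rule test_function_bump[OF e])
      then have "bochner_int ?M (\<lambda>t. (deriv ^^ n) \<phi> t *\<^sub>R g t) = (-1) ^ n *\<^sub>R bochner_int ?M (\<lambda>t. \<phi> t *\<^sub>R v t)"
        using weak unfolding has_weak_deriv_def g_def by blast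
      moreover have "(deriv ^^ n) \<phi> = (\<lambda>t. bump q m ((t - a) / e) / e ^ n)"
        unfolding \<phi>_def using qm(1) e(1) by blast
      ultimately show ?thesis by (simp only: u_def[abs_def])
    qed
    moreover have "norm (bochner_int ?M (\<lambda>t. \<phi> t *\<^sub>R v t)) \<le> V * (e * P)"
    proof (rule bochner_int_norm_bound)
      show "has_bochner_integral ?M (\<lambda>t. V * \<bar>\<phi> t\<bar>) (V * (e * P))"
        unfolding P_def \<phi>_def using e
        by (intro has_bochner_integral_mult_right
            has_bochner_integral_rescaled[where \<psi> = "\<lambda>r. \<bar>bump 1 0 r\<bar>"] continuous_intros continuous_on_bump)
          (auto simp: bump_eq_0)
      show "norm (\<phi> t *\<^sub>R v t) \<le> V * \<bar>\<phi> t\<bar>" if "t \<in> space ?M" for t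
        using mult_right_mono[OF V[of t] abs_ge_zero[of "\<phi> t"]] that by (simp add: mult.commute)
    qed
    ultimately have "norm (bochner_int ?M u) \<le> V * (e * P)" by simp
    then have "norm ((A * (e * I)) *\<^sub>R z) \<le> V * (e * P) + \<eta> * A * (e * K)"
      using L norm_triangle_sub[of "(A * (e * I)) *\<^sub>R z" "bochner_int ?M u"] by (simp add: norm_minus_commute)
    then have "A * e * (\<bar>I\<bar> * norm z) \<le> e * (V * P) + A * e * (\<eta> * K)"
      using \<open>A > 0\<close> e by (simp add: abs_mult mult_ac)
    then have "A * (\<bar>I\<bar> * norm z) \<le> V * P + A * (\<eta> * K)"
      using e(1) by (simp add: mult.left_commute[of A e] mult.assoc flip: distrib_left)
    \<comment> \<open>This power of \<open>e\<close> turns \<open>A\<close> into the constant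
      \<open>C\<close> and puts the vanishing factor on the contribution of
      \<open>v\<close>.\<close>
    then have "e powr (real n - \<beta>) * (A * (\<bar>I\<bar> * norm z)) \<le> e powr (real n - \<beta>) * (V * P + A * (\<eta> * K))"
      by (rule mult_left_mono) simp
    moreover have C: "C = e powr (real n - \<beta>) * A"
      using e by (simp add: A_def powr_diff powr_realpow)
    ultimately show ?thesis unfolding C by (simp add: algebra_simps)
  qed
  have "C * \<bar>I\<bar> * norm z \<le> \<eta> * C * K" if \<eta>: "\<eta> > 0" for \<eta>
  proof -
    obtain \<delta> where \<delta>: "\<delta> > 0" "\<And>t. a \<le> t \<Longrightarrow> t \<le> a + \<delta> \<Longrightarrow> norm (f t - (t - a) ^ j *\<^sub>R z) \<le> \<eta> * (t - a) ^ j"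
      using near[OF \<eta>] by blast
    show ?thesis
    proof (rule le_if_le_plus_powr)
      \<comment> \<open>Here \<open>e\<close> tends to 0 with \<eta> fixed. The gap between j and n
        makes the exponent positive: \<beta> = j + \<gamma> < j + 1 \<le> n.\<close>
      have "real j + 1 \<le> real n" using \<open>j < n\<close> by linarith
      then show "real n - \<beta> > 0" using \<gamma> by (simp add: \<beta>_def)
      show "min (\<delta> / 2) ((b - a) / 2) > 0" using \<delta>(1) \<open>a < b\<close> by simp
      show "C * \<bar>I\<bar> * norm z \<le> V * P * e powr (real n - \<beta>) + \<eta> * C * K"
        if "0 < e" "e < min (\<delta> / 2) ((b - a) / 2)" for e
        using that by (intro main[where \<delta> = \<delta>] \<eta> \<delta>(2)) auto
    qed
  qed
  then have "C * \<bar>I\<bar> * norm z \<le> 0"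
    \<comment> \<open>The same limit argument, now with exponent 1 and \<eta> as the variable
      tending to 0.\<close>
    using le_if_le_plus_powr[of 1 1 "C * \<bar>I\<bar> * norm z" "C * K" 0] by (simp add: mult_ac)
  then show ?thesis
    using \<open>C > 0\<close> \<open>I \<noteq> 0\<close> by (simp add: mult_le_0_iff zero_less_mult_iff)
qed

text \<open>Strong induction on j: once the lower derivatives vanish at \<open>a\<close>, the Taylor
  expansion starts at order j, and its leading coefficient must vanish as well.\<close>

lemma RL_space_derivs_zero:
  fixes f :: "real \<Rightarrow> 'a::banach"
  assumes "a < b" "\<alpha> > 0" "\<alpha> \<notin> \<nat>" and f: "f \<in> RL_space a b \<alpha>" and "j < nat \<lceil>\<alpha>\<rceil>"
  shows "(deriv_on a b ^^ j) f a = 0"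
  using \<open>j < nat \<lceil>\<alpha>\<rceil>\<close>
proof (induction j rule: less_induct)
  case (less j)
  define n where "n = nat \<lceil>\<alpha>\<rceil>"
  define \<gamma> where "\<gamma> = of_int \<lceil>\<alpha>\<rceil> - \<alpha>"
  let ?D = "\<lambda>i. (deriv_on a b ^^ i) f"
  have "\<alpha> \<noteq> of_int \<lceil>\<alpha>\<rceil>"
    using assms(2,3) by (metis Ints_of_int Nats_altdef2 less_imp_le mem_Collect_eq)
  then have \<gamma>: "0 < \<gamma>" "\<gamma> < 1" unfolding \<gamma>_def by linarith+
  from f obtain v where fC: "f \<in> Ck_space a b (n - 1)" and v: "v \<in> Ck_space a b 0" "has_RL_deriv a b \<alpha> f v"
    by (auto simp: RL_space_def n_def)
  have diff: "?D i differentiable (at t within {a..b})" if "i < n - 1" "t \<in> {a..b}" for i t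
    using fC that by (simp add: Ck_space_def)
  have cont: "continuous_on {a..b} (?D i)" if "i \<le> n - 1" for i
    using fC that by (simp add: Ck_space_def)
  have jn: "j < n" using less.prems by (simp add: n_def)
  have "?D j a /\<^sub>R fact j = 0"
  proof (rule RL_deriv_leading_coeff_zero[OF \<open>a < b\<close> \<gamma> jn])
    show "continuous_on {a..b} f" using cont[of 0] by simp
    show "continuous_on {a..b} v" using v(1) by (simp add: Ck_space_def)
    show "has_weak_deriv a b n (RL_integral a \<gamma> f) v"
      using v(2) by (simp add: has_RL_deriv_def n_def \<gamma>_def)
    fix \<eta> :: real assume "\<eta> > 0"
    have "\<exists>\<delta>>0. \<forall>t. a \<le> t \<and> t \<le> a + \<delta> \<longrightarrow>
           norm (?D 0 t - (t - a) ^ j *\<^sub>R (?D j a /\<^sub>R fact j)) \<le> \<eta> * (t - a) ^ j"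
    \<comment> \<open>From j < n follows j \<le> n - 1, the order up to which \<open>f\<close> is
      continuously differentiable; so \<open>?D j\<close> is still continuous.\<close>
    proof (rule Taylor_first_nonzero_term[of j a b "?D"])
      show "(?D i has_vector_derivative ?D (Suc i) t) (at t within {a..b})"
        if "i < j" "t \<in> {a..b}" for i t
        using diff[of i t] that jn by (simp add: vector_derivative_works deriv_on_def)
    qed (use less jn cont \<open>a < b\<close> \<open>\<eta> > 0\<close> in \<open>auto simp: n_def\<close>)
    then show "\<exists>\<delta>>0. \<forall>t. a \<le> t \<and> t \<le> a + \<delta> \<longrightarrow>
           norm (f t - (t - a) ^ j *\<^sub>R (?D j a /\<^sub>R fact j)) \<le> \<eta> * (t - a) ^ j"
      by simp
  qed
  then show ?case by simp
qed

section \<open>Comparison of the Caputo and Riemann-Liouville derivatives\<close>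

lemma has_Caputo_deriv_iff_if_Nats:
  fixes f :: "real \<Rightarrow> 'a::banach"
  assumes "\<alpha> \<in> \<nat>"
  shows "has_Caputo_deriv a b \<alpha> f v \<longleftrightarrow> has_RL_deriv a b \<alpha> f v"
proof -
  obtain k where "\<alpha> = real k" using assms by (rule Nats_cases)
  \<comment> \<open>For integral \<alpha> the order of the fractional integral is 0, where
    \<open>RL_integral\<close> is the identity by its case distinction.\<close>
  then have 0: "of_int \<lceil>\<alpha>\<rceil> - \<alpha> = 0" by simp
  have f: "RL_integral a 0 f = f" by (simp add: RL_integral_def fun_eq_iff)
  show ?thesis using assms unfolding has_Caputo_deriv_def has_RL_deriv_def 0 f by simp
qed

text \<open>For nonintegral \<alpha> every coefficient of the subtracted Taylor polynomial is zero,
  so the Caputo derivative is taken of \<open>f\<close> itself.\<close>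

lemma RL_space_has_Caputo_deriv_iff:
  fixes f :: "real \<Rightarrow> 'a::banach"
  assumes "a < b" "\<alpha> > 0" "f \<in> RL_space a b \<alpha>"
  shows "has_Caputo_deriv a b \<alpha> f v \<longleftrightarrow> has_RL_deriv a b \<alpha> f v"
proof (cases "\<alpha> \<in> \<nat>")
  case True
  then show ?thesis by (rule has_Caputo_deriv_iff_if_Nats)
next
  case False
  have "(\<Sum>j<nat \<lceil>\<alpha>\<rceil>. ((t - a) ^ j / fact j) *\<^sub>R (deriv_on a b ^^ j) f a) = 0" for t
    using RL_space_derivs_zero[OF assms(1,2) False assms(3)] by simp
  then show ?thesis using False by (simp add: has_Caputo_deriv_def)
qed

section \<open>Constants belong to the Caputo space\<close>

lemma deriv_on_funpow_const:
  fixes x :: "'a::real_normed_vector"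
  assumes "a < b"
  shows "(deriv_on a b ^^ j) (\<lambda>t. if t \<in> {a..b} then x else 0) =
     (\<lambda>t. if j = 0 \<and> t \<in> {a..b} then x else 0)"
proof (induction j)
  case (Suc j)
  have "vector_derivative (\<lambda>t. if j = 0 \<and> t \<in> {a..b} then x else 0) (at t within {a..b}) = 0"
    if t: "t \<in> {a..b}" for t
  proof (rule vector_derivative_within_cbox[of a b, unfolded box_real])
    show "((\<lambda>t. if j = 0 \<and> t \<in> {a..b} then x else 0) has_vector_derivative 0) (at t within {a..b})"
      by (rule has_vector_derivative_transform[of t _ _ "\<lambda>t. if j = 0 then x else 0"]) (use t in auto)
  qed (use t \<open>a < b\<close> in auto)
  then have "deriv_on a b (\<lambda>t. if j = 0 \<and> t \<in> {a..b} then x else 0) = (\<lambda>t. 0)"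
    by (simp add: deriv_on_def fun_eq_iff)
  then show ?case unfolding funpow.simps comp_apply Suc by simp
qed auto

text \<open>A constant is its own Taylor polynomial, so the Caputo derivative acts on a function
  vanishing on [a, b], and 0 is a weak derivative.\<close>

lemma const_in_Caputo_space:
  fixes x :: "'a::banach"
  assumes "a < b" "\<alpha> > 0" "\<alpha> \<notin> \<nat>"
  shows "(\<lambda>t. if t \<in> {a..b} then x else 0) \<in> Caputo_space a b \<alpha>"
proof -
  let ?f = "\<lambda>t. if t \<in> {a..b} then x else 0"
  let ?n = "nat \<lceil>\<alpha>\<rceil>"
  have n: "?n > 0" using assms(2) by simp
  have D: "(deriv_on a b ^^ j) ?f = (\<lambda>t. if j = 0 \<and> t \<in> {a..b} then x else 0)" for j
    by (rule deriv_on_funpow_const[OF assms(1)])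
  have "((\<lambda>t. if j = 0 \<and> t \<in> {a..b} then x else 0) has_vector_derivative 0) (at t within {a..b})"
    if "t \<in> {a..b}" for j :: nat and t
    by (rule has_vector_derivative_transform[of t _ _ "\<lambda>t. if j = (0::nat) then x else 0"]) (use that in auto)
  then have diff: "(\<lambda>t. if j = 0 \<and> t \<in> {a..b} then x else 0) differentiable (at t within {a..b})"
    if "t \<in> {a..b}" for j :: nat and t
    using that differentiableI_vector by blast
  have cont: "continuous_on {a..b} (\<lambda>t. if j = 0 \<and> t \<in> {a..b} then x else 0)" for j :: nat
    using diff by (intro differentiable_imp_continuous_on) (simp add: differentiable_on_def)
  have Ck: "?f \<in> Ck_space a b k" for k
    unfolding Ck_space_def mem_Collect_eq D
    using diff cont by auto
  \<comment> \<open>Only the term j = 0 survives, and it is present since \<open>?n\<close> is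
    positive. The polynomial equals \<open>x\<close> on the whole line, unlike the cut-off function
    \<open>?f\<close>.\<close>
  have sum: "(\<Sum>j<?n. ((t - a) ^ j / fact j) *\<^sub>R (deriv_on a b ^^ j) ?f a) = x" for t
    unfolding D using n assms(1) by (simp add: if_distrib[of "\<lambda>y. _ *\<^sub>R y"] cong: if_cong)
  define h where "h t = ?f t - x" for t
  define g where "g = RL_integral a (of_int \<lceil>\<alpha>\<rceil> - \<alpha>) h"
  \<comment> \<open>Outside [a, b] the function \<open>h\<close> equals -x, but for t in [a, b] the
    fractional integral sees \<open>h\<close> only on [a, t], where it is 0.\<close>
  have g: "g t = 0" if "t \<in> {a..b}" for t
  proof -
    have "bochner_int (lebesgue_on {a..t}) (\<lambda>s. (t - s) powr (of_int \<lceil>\<alpha>\<rceil> - \<alpha> - 1) *\<^sub>R h s) =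
        bochner_int (lebesgue_on {a..t}) (\<lambda>s. 0)"
      by (rule bochner_int_cong) (use that in \<open>auto simp: h_def\<close>)
    then show ?thesis
      using that by (simp add: g_def RL_integral_def h_def bochner_int_eq[OF has_bochner_int_zero])
  qed
  have "has_weak_deriv a b ?n g (\<lambda>t. 0)"
    unfolding has_weak_deriv_def loc_integrable_def
  proof (intro conjI allI impI)
    show "bochner_integrable (lebesgue_on {c..d}) (\<lambda>t. 0::'a)" for c d
      using has_bochner_int_zero by (auto simp: bochner_integrable_def)
    then show "bochner_integrable (lebesgue_on {c..d}) g" if "a < c \<and> c \<le> d \<and> d < b" for c d
      using bochner_int_cong(2)[of "lebesgue_on {c..d}" g "\<lambda>t. 0"] g that by auto
    fix \<phi>
    have "bochner_int (lebesgue_on {a..b}) (\<lambda>t. (deriv ^^ ?n) \<phi> t *\<^sub>R g t) = bochner_int (lebesgue_on {a..b}) (\<lambda>t. 0)"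
      by (rule bochner_int_cong) (use g in auto)
    then show "bochner_int (lebesgue_on {a..b}) (\<lambda>t. (deriv ^^ ?n) \<phi> t *\<^sub>R g t)
        = (-1) ^ ?n *\<^sub>R bochner_int (lebesgue_on {a..b}) (\<lambda>t. \<phi> t *\<^sub>R 0)"
      by (simp add: bochner_int_eq[OF has_bochner_int_zero])
  qed
  then have "has_Caputo_deriv a b \<alpha> ?f (\<lambda>t. 0)"
    using assms(3) unfolding has_Caputo_deriv_def has_RL_deriv_def sum g_def h_def by simp
  moreover have "(\<lambda>t. 0) \<in> Ck_space a b 0" by (simp add: Ck_space_def)
  ultimately show ?thesis using Ck unfolding Caputo_space_def by blast
qed

theorem proposition11:
  fixes t0 t1 \<alpha> :: real
  assumes "t0 < t1" and "\<alpha> > 0"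
  shows "continuously_embedded
           (RL_space t0 t1 \<alpha> :: (real \<Rightarrow> 'a::banach) set) (RL_norm t0 t1 \<alpha>)
           (Caputo_space t0 t1 \<alpha>) (Caputo_norm t0 t1 \<alpha>) \<and>
         (\<alpha> \<in> \<nat> \<longrightarrow>
           (RL_space t0 t1 \<alpha> :: (real \<Rightarrow> 'a) set) = Caputo_space t0 t1 \<alpha>) \<and>
         (\<alpha> \<notin> \<nat> \<longrightarrow> (\<exists>x::'a. x \<noteq> 0) \<longrightarrow>
           (RL_space t0 t1 \<alpha> :: (real \<Rightarrow> 'a) set) \<subset> Caputo_space t0 t1 \<alpha>)"
proof (intro conjI impI)
  let ?RL = "RL_space t0 t1 \<alpha> :: (real \<Rightarrow> 'a) set" and ?C = "Caputo_space t0 t1 \<alpha> :: (real \<Rightarrow> 'a) set"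
  note iff = RL_space_has_Caputo_deriv_iff[OF assms]
  have sub: "?RL \<subseteq> ?C"
    using iff by (auto simp: RL_space_def Caputo_space_def)
  \<comment> \<open>Both derivatives are definite descriptions over equivalent predicates, hence
    equal. The norms therefore agree on the smaller space, and the embedding constant is 1.\<close>
  have "Caputo_norm t0 t1 \<alpha> f = RL_norm t0 t1 \<alpha> f" if "f \<in> ?RL" for f
    using iff[OF that] by (simp add: Caputo_norm_def RL_norm_def Caputo_deriv_def RL_deriv_def)
  then show "continuously_embedded ?RL (RL_norm t0 t1 \<alpha>) ?C (Caputo_norm t0 t1 \<alpha>)"
    unfolding continuously_embedded_def using sub by (intro conjI exI[of _ 1]) auto
  show "?RL = ?C" if "\<alpha> \<in> \<nat>"
    by (simp add: RL_space_def Caputo_space_def has_Caputo_deriv_iff_if_Nats[OF that])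
  show "?RL \<subset> ?C" if \<alpha>: "\<alpha> \<notin> \<nat>" and nz: "\<exists>x::'a. x \<noteq> 0"
  proof -
    obtain x :: 'a where "x \<noteq> 0" using nz by blast
    let ?f = "\<lambda>t. if t \<in> {t0..t1} then x else 0"
    \<comment> \<open>Membership would force the value at \<open>t0\<close>, the derivative of order
      0, to vanish, but this value is \<open>x\<close>.\<close>
    have "?f \<notin> ?RL"
      using RL_space_derivs_zero[OF assms \<alpha>, of ?f 0] assms \<open>x \<noteq> 0\<close> by auto
    moreover have "?f \<in> ?C" by (rule const_in_Caputo_space[OF assms \<alpha>])
    ultimately show ?thesis using sub by blast
  qed
qed

end
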